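(* Let $p\in(0,1)^n$, $k\in\{0,\dots,n\}$ and $\pi=\pi(p,k)$. Let $f\colon\mathcal{B}_n\to\mathcal{H}_d$ be such that there are positive semidefinite matrices $C_1,\dots,C_n$ with \[ (f(x)-f(x^i))^2\preccurlyeq C_i^2\quad\text{for all }x\in\mathcal{B}_n,\ i\in[n]. \] Set \[ \sigma^2=16\sup\Big\{\Big\|\sum_{i\in\mathcal{I}}C_i^2\Big\|:\ \mathcal{I}\subset[n],\ |\mathcal{I}|=k\Big\}. \] Then for any $t>0$, \[ \pi\big(\lambda_{\max}(f-\pi(f))>t\big)\le d\exp\big(-t^2/(\sigma^2+\sigma t)\big). \]
   Context: $\mathcal{B}_n=\{0,1\}^n$. For $p\in(0,1)^n$ let $B_1,\dots,B_n$ be independent Bernoulli variables with $\mathbb{P}(B_i=1)=p_i$; $\pi(p,k)$ is the law of $(B_1,\dots,B_n)$ conditioned on $\sum_iB_i=k$. $\mathcal{H}_d$ is the space of $d\times d$ Hermitian matrices, $\preccurlyeq$ the positive semidefinite order, $\|\cdot\|$ the operator norm, $\lambda_{\max}$ the largest eigenvalue, $\pi(f)=\int f\,d\pi$ entrywise; $x^i$ is $x$ with its $i$-th coordinate flipped. *)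

theory Defs
  imports "HOL-Analysis.Analysis" "HOL-Probability.Probability"
begin

definition cube :: "nat \<Rightarrow> (nat \<Rightarrow> bool) set" where
  "cube n = {x. \<forall>i. n \<le> i \<longrightarrow> \<not> x i}"

definition flip :: "(nat \<Rightarrow> bool) \<Rightarrow> nat \<Rightarrow> (nat \<Rightarrow> bool)" where
  "flip x i = x(i := \<not> x i)"

definition bern_prod :: "nat \<Rightarrow> (nat \<Rightarrow> real) \<Rightarrow> (nat \<Rightarrow> bool) pmf" where
  "bern_prod n p = Pi_pmf {..<n} False (\<lambda>i. bernoulli_pmf (p i))"

definition cond_bern :: "nat \<Rightarrow> (nat \<Rightarrow> real) \<Rightarrow> nat \<Rightarrow> (nat \<Rightarrow> bool) pmf" where
  "cond_bern n p k = cond_pmf (bern_prod n p) {x. card {i. i < n \<and> x i} = k}"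

definition hermitian :: "complex ^'d ^'d \<Rightarrow> bool" where
  "hermitian A \<longleftrightarrow> (\<forall>i j. A $ i $ j = cnj (A $ j $ i))"

definition psd :: "complex ^'d ^'d \<Rightarrow> bool" where
  "psd A \<longleftrightarrow> hermitian A \<and>
     (\<forall>v::complex ^'d. 0 \<le> Re (\<Sum>i\<in>UNIV. cnj (v $ i) * (A *v v) $ i))"

definition loewner_le :: "complex ^'d ^'d \<Rightarrow> complex ^'d ^'d \<Rightarrow> bool" (infix "\<preceq>\<^sub>L" 50) where
  "A \<preceq>\<^sub>L B \<longleftrightarrow> psd (B - A)"

definition lambda_max :: "complex ^'d ^'d \<Rightarrow> real" where
  "lambda_max A = Max {r::real. \<exists>v. v \<noteq> 0 \<and> A *v v = complex_of_real r *s v}"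

definition op_norm :: "complex ^'d ^'d \<Rightarrow> real" where
  "op_norm A = onorm (\<lambda>v. A *v v)"

end

(*
Let x and y be independent with law pi. By convexity of the exponential, f - pi(f) may be replaced
by F = f(x) - f(y), at no cost in the dimensional factor. Choose moreover a uniformly random
bijection between the elements of x outside y and those of y outside x. Exchanging a matched pair
i, j between x and y preserves the joint law, because pi(x) pi(y) only depends on the multiset
union of x and y. These exchanges are commuting involutions, and performing all of them interchanges
x and y, hence changes the sign of F. For an odd function of such signs the Poincare inequality of
the discrete cube reads E|g|^2 <= (1/4) sum_s E|g - g o tau_s|^2. Applied to g = sinh(theta F / 2)
in the Hilbert-Schmidt norm, together with
  |sinh A - sinh B|^2 <= (1/2) tr (A - B)^2 (cosh^2 A + cosh^2 B)
and |(F - F o tau_s) v|^2 <= 8 (|C_i v|^2 + |C_j v|^2), it gives, with a = theta^2 sigma^2 / 16,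
  E tr sinh^2(theta F / 2) <= a E tr cosh^2(theta F / 2).
Since E tr sinh(theta F) = 0, this bounds E tr exp(theta F) by d (1 + a) / (1 - a), and the choice
theta = 2 t / (sigma (sigma + t)) in Markov's inequality finishes the proof.

Hermitian matrices are treated as self-adjoint operators on the real Euclidean space underlying
the complex one, so all traces are doubled.
*)
theory Submission
  imports Defs
begin

subsection \<open>Self-adjoint operators\<close>

definition selfadjoint :: "('a::real_inner \<Rightarrow> 'a) \<Rightarrow> bool" where
  "selfadjoint A \<longleftrightarrow> (\<forall>v w. A v \<bullet> w = v \<bullet> A w)"

lemma selfadjointD: "selfadjoint A \<Longrightarrow> A v \<bullet> w = v \<bullet> A w"
  by (simp add: selfadjoint_def)

text \<open>Moving the operator across the inner product reduces linearity to that of the inner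
  product, and a vector is determined by its inner products.\<close>

lemma selfadjoint_linear:
  assumes "selfadjoint A"
  shows "linear A"
proof (rule linearI)
  show "A (v + w) = A v + A w" for v w
    by (rule vector_eq_rdot[THEN iffD1]) (simp add: selfadjointD[OF assms] inner_left_distrib)
  show "A (c *\<^sub>R v) = c *\<^sub>R A v" for c v
    by (rule vector_eq_rdot[THEN iffD1]) (simp add: selfadjointD[OF assms])
qed

lemma selfadjoint_diff: "selfadjoint A \<Longrightarrow> selfadjoint B \<Longrightarrow> selfadjoint (\<lambda>v. A v - B v)"
  by (simp add: selfadjoint_def inner_diff_left inner_diff_right)

lemma selfadjoint_uminus: "selfadjoint A \<Longrightarrow> selfadjoint (\<lambda>v. - A v)"
  by (simp add: selfadjoint_def)

lemma selfadjoint_scaleR: "selfadjoint A \<Longrightarrow> selfadjoint (\<lambda>v. c *\<^sub>R A v)"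
  by (simp add: selfadjoint_def)

definition orthonormal_basis :: "'a::euclidean_space set \<Rightarrow> bool" where
  "orthonormal_basis B \<longleftrightarrow>
     finite B \<and> pairwise orthogonal B \<and> (\<forall>b\<in>B. norm b = 1) \<and> span B = UNIV"

lemma orthonormal_basis_finite: "orthonormal_basis B \<Longrightarrow> finite B"
  by (simp add: orthonormal_basis_def)

lemma orthonormal_basis_Basis: "orthonormal_basis Basis"
  by (auto simp: orthonormal_basis_def pairwise_def orthogonal_def inner_not_same_Basis)

lemma orthonormal_basis_expansion:
  assumes "orthonormal_basis B"
  shows "(\<Sum>b\<in>B. (b \<bullet> v) *\<^sub>R b) = v"
  using orthonormal_basis_expand[of B v] assms
  by (simp add: orthonormal_basis_def inner_commute)

lemma orthonormal_basis_inner: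
  assumes "orthonormal_basis B"
  shows "v \<bullet> w = (\<Sum>b\<in>B. (b \<bullet> v) * (b \<bullet> w))"
proof -
  have "v \<bullet> w = v \<bullet> (\<Sum>b\<in>B. (b \<bullet> w) *\<^sub>R b)"
    by (simp add: orthonormal_basis_expansion[OF assms])
  then show ?thesis
    by (simp add: inner_sum_right inner_commute mult.commute)
qed

lemma orthonormal_basis_norm:
  assumes "orthonormal_basis B"
  shows "(norm v)\<^sup>2 = (\<Sum>b\<in>B. (b \<bullet> v)\<^sup>2)"
  unfolding power2_norm_eq_inner orthonormal_basis_inner[OF assms, of v v]
  by (simp add: power2_eq_square)

lemma orthonormal_basis_card:
  assumes "orthonormal_basis (B :: 'a::euclidean_space set)"
  shows "card B = DIM('a)"
proof -
  have "0 \<notin> B"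
    using assms by (auto simp: orthonormal_basis_def)
  then have "independent B"
    using assms pairwise_orthogonal_independent by (auto simp: orthonormal_basis_def)
  moreover have "span B = UNIV"
    using assms by (simp add: orthonormal_basis_def)
  ultimately show ?thesis
    by (metis dim_UNIV dim_span_eq_card_independent)
qed

text \<open>Maximise \<open>v \<bullet> A v\<close> over the unit sphere of \<open>V\<close>. At a
  maximiser the first variation vanishes, so \<open>A v\<close> is orthogonal to every
  \<open>w\<close> in \<open>V\<close> orthogonal to \<open>v\<close>; the vector
  \<open>A v - l *\<^sub>R v\<close> is itself such a \<open>w\<close>, hence zero.\<close>

lemma selfadjoint_eigenvector_exists:
  fixes A :: "'a::euclidean_space \<Rightarrow> 'a"
  assumes A: "selfadjoint A" and V: "subspace V" "\<And>v. v \<in> V \<Longrightarrow> A v \<in> V"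
    and "V \<noteq> {0}"
  shows "\<exists>v\<in>V. norm v = 1 \<and> A v = (v \<bullet> A v) *\<^sub>R v"
proof -
  have lin: "linear A" by (rule selfadjoint_linear[OF A])
  obtain w0 where w0: "w0 \<in> V" "w0 \<noteq> 0"
    using \<open>V \<noteq> {0}\<close> subspace_0[OF V(1)] by auto
  let ?K = "sphere 0 1 \<inter> V"
  have "compact ?K"
    using closed_subspace[OF V(1)] by (intro compact_Int_closed) auto
  moreover have "w0 /\<^sub>R norm w0 \<in> ?K"
    using w0 V(1) by (auto simp: subspace_scale)
  moreover have "continuous_on ?K (\<lambda>v. v \<bullet> A v)"
    by (intro continuous_intros linear_continuous_on) (use lin linear_conv_bounded_linear in auto)
  ultimately obtain v where v: "v \<in> ?K" and max: "\<And>w. w \<in> ?K \<Longrightarrow> w \<bullet> A w \<le> v \<bullet> A v"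
    using continuous_attains_sup[of ?K "\<lambda>v. v \<bullet> A v"] by blast
  have vv: "v \<bullet> v = 1" "v \<in> V" using v by (auto simp: norm_eq_1)
  define l where "l = v \<bullet> A v"
  have bound: "w \<bullet> A w \<le> l * (w \<bullet> w)" if "w \<in> V" for w
  proof (cases "w = 0")
    case False
    then have "w /\<^sub>R norm w \<in> ?K" using that V(1) by (auto simp: subspace_scale)
    from max[OF this] have "(w \<bullet> A w) / (norm w)\<^sup>2 \<le> l"
      using lin by (simp add: l_def linear_scale power2_eq_square divide_inverse mult_ac)
    then show ?thesis using False by (simp add: divide_le_eq power2_norm_eq_inner)
  qed simp
  have orth: "w \<bullet> A v = 0" if w: "w \<in> V" "w \<bullet> v = 0" for w
  proof -
    define \<beta> \<gamma> where "\<beta> = w \<bullet> A v" and "\<gamma> = l * (w \<bullet> w) - w \<bullet> A w"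
    have q: "2 * t * \<beta> \<le> t\<^sup>2 * \<gamma>" for t
    proof -
      have "v + t *\<^sub>R w \<in> V" using w vv V(1) by (simp add: subspace_add subspace_scale)
      from bound[OF this] have "l + t * (v \<bullet> A w) + t * (w \<bullet> A v) + t\<^sup>2 * (w \<bullet> A w) \<le> l * (1 + t\<^sup>2 * (w \<bullet> w))"
        using w(2) lin vv
        by (simp add: linear_add linear_scale inner_add_left inner_add_right l_def inner_commute[of v w]
            power2_eq_square algebra_simps)
      moreover have "v \<bullet> A w = \<beta>" using selfadjointD[OF A, of v w] by (simp add: \<beta>_def inner_commute)
      ultimately show ?thesis by (simp add: \<beta>_def \<gamma>_def algebra_simps)
    qed
    have g: "\<gamma> \<ge> 0" using bound[OF w(1)] by (simp add: \<gamma>_def)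
    \<comment> \<open>The optimal parameter would be of order \<open>\<beta> / \<gamma>\<close>;
      adding 1 to the denominator covers the case \<open>\<gamma> = 0\<close> as well.\<close>
    have "2 * (\<beta> / (\<gamma> + 1)) * \<beta> \<le> (\<beta> / (\<gamma> + 1))\<^sup>2 * \<gamma>" by (rule q)
    then have "2 * \<beta>\<^sup>2 * (\<gamma> + 1) \<le> \<beta>\<^sup>2 * \<gamma>" using g
      by (simp add: divide_simps power2_eq_square mult_ac split: if_splits)
    then have "\<beta>\<^sup>2 * (\<gamma> + 2) \<le> 0" by (simp add: algebra_simps)
    then have "\<beta>\<^sup>2 \<le> 0" using g by (smt (verit) mult_pos_pos zero_le_power2)
    then show ?thesis by (simp add: \<beta>_def)
  qed
  define w where "w = A v - l *\<^sub>R v"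
  have "w \<in> V" using V vv by (simp add: w_def subspace_diff subspace_scale)
  moreover have wv: "w \<bullet> v = 0"
    using selfadjointD[OF A, of v v] by (simp add: w_def l_def inner_diff_left vv)
  ultimately have "w \<bullet> A v = 0" by (rule orth)
  then have "w \<bullet> w = 0"
    using wv by (simp add: w_def inner_diff_right inner_commute)
  then have "A v = l *\<^sub>R v" by (simp add: w_def)
  then show ?thesis using v by (auto simp: l_def)
qed

text \<open>Split off one unit eigenvector \<open>v\<close>; its orthogonal complement
  \<open>W\<close> in \<open>V\<close> is again invariant and of smaller dimension. Invariant
  subspaces appear in the statement to make this induction possible.\<close>

lemma selfadjoint_diagonalizable_on:
  fixes A :: "'a::euclidean_space \<Rightarrow> 'a"
  assumes A: "selfadjoint A" and "subspace V" "\<And>v. v \<in> V \<Longrightarrow> A v \<in> V"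
  shows "\<exists>B. finite B \<and> pairwise orthogonal B \<and> span B = V \<and>
           (\<forall>b\<in>B. norm b = 1 \<and> A b = (b \<bullet> A b) *\<^sub>R b)"
  using assms(2,3)
proof (induction "dim V" arbitrary: V rule: less_induct)
  case (less V)
  show ?case
  proof (cases "V = {0}")
    case True
    then show ?thesis by (intro exI[of _ "{}"]) (auto simp: pairwise_def)
  next
    case False
    obtain v where v: "v \<in> V" "norm v = 1" "A v = (v \<bullet> A v) *\<^sub>R v"
      using selfadjoint_eigenvector_exists[OF A less.prems False] by blast
    define W where "W = {w \<in> V. v \<bullet> w = 0}"
    have W: "subspace W"
      using less.prems(1) by (auto simp: W_def subspace_def inner_add_right)
    have AW: "A w \<in> W" if "w \<in> W" for w
    proof -
      have "v \<bullet> A w = (v \<bullet> A v) * (v \<bullet> w)"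
        using selfadjointD[OF A, of v w] v(3) by (metis inner_scaleR_left)
      then show ?thesis using that less.prems(2) by (auto simp: W_def)
    qed
    have "v \<notin> W" using v(2) by (auto simp: W_def norm_eq_1)
    moreover have "W \<subseteq> V" by (auto simp: W_def)
    ultimately have "W \<subset> V" using v(1) by blast
    then have "dim W < dim V"
      using dim_psubset[of W V] W less.prems(1) by (metis span_eq_iff)
    from less.hyps[OF this W AW] obtain B where B: "finite B" "pairwise orthogonal B" "span B = W"
      "\<And>b. b \<in> B \<Longrightarrow> norm b = 1 \<and> A b = (b \<bullet> A b) *\<^sub>R b"
      by blast
    have BW: "B \<subseteq> W" using B(3) span_superset by blast
    have "span (insert v B) = V"
    proof
      have "insert v B \<subseteq> V" using v(1) BW by (auto simp: W_def)
      then show "span (insert v B) \<subseteq> V" using less.prems(1) by (rule span_minimal)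
      show "V \<subseteq> span (insert v B)"
      proof
        fix x assume x: "x \<in> V"
        have "x - (v \<bullet> x) *\<^sub>R v \<in> W"
          using x v less.prems(1)
          by (auto simp: W_def subspace_diff subspace_scale inner_diff_right norm_eq_1)
        then show "x \<in> span (insert v B)"
          by (auto simp: B(3) span_insert)
      qed
    qed
    moreover have "pairwise orthogonal (insert v B)"
      using B(2) BW by (auto simp: pairwise_insert W_def orthogonal_def inner_commute)
    ultimately show ?thesis
      using B v by (intro exI[of _ "insert v B"]) auto
  qed
qed

text \<open>One fixed choice for each operator. The eigenvalue belonging to \<open>b\<close> is
  written \<open>b \<bullet> A b\<close>, so the basis vectors index the spectrum with
  multiplicity.\<close>

definition eigenbasis :: "('a::euclidean_space \<Rightarrow> 'a) \<Rightarrow> 'a set" where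
  "eigenbasis A = (SOME B. orthonormal_basis B \<and> (\<forall>b\<in>B. A b = (b \<bullet> A b) *\<^sub>R b))"

lemma
  assumes "selfadjoint A"
  shows orthonormal_eigenbasis: "orthonormal_basis (eigenbasis A)"
    and eigenbasis_eigenvector: "b \<in> eigenbasis A \<Longrightarrow> A b = (b \<bullet> A b) *\<^sub>R b"
proof -
  have "\<exists>B. orthonormal_basis B \<and> (\<forall>b\<in>B. A b = (b \<bullet> A b) *\<^sub>R b)"
    using selfadjoint_diagonalizable_on[OF assms subspace_UNIV] unfolding orthonormal_basis_def by blast
  from someI_ex[OF this] show "orthonormal_basis (eigenbasis A)"
    and "b \<in> eigenbasis A \<Longrightarrow> A b = (b \<bullet> A b) *\<^sub>R b"
    unfolding eigenbasis_def by blast+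
qed

section \<open>Functional calculus and traces of functions of an operator\<close>

definition fcalc :: "(real \<Rightarrow> real) \<Rightarrow> ('a::euclidean_space \<Rightarrow> 'a) \<Rightarrow> 'a \<Rightarrow> 'a" where
  "fcalc \<phi> A v = (\<Sum>b\<in>eigenbasis A. \<phi> (b \<bullet> A b) *\<^sub>R (b \<bullet> v) *\<^sub>R b)"

definition trf :: "(real \<Rightarrow> real) \<Rightarrow> ('a::euclidean_space \<Rightarrow> 'a) \<Rightarrow> real" where
  "trf \<phi> A = (\<Sum>b\<in>eigenbasis A. \<phi> (b \<bullet> A b))"

lemma selfadjoint_fcalc: "selfadjoint (fcalc \<phi> A)"
  unfolding selfadjoint_def fcalc_def
  by (simp add: inner_sum_left inner_sum_right inner_commute mult_ac)

text \<open>Eigenvectors for different eigenvalues are orthogonal, so only basis vectors with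
  eigenvalue \<open>\<mu>\<close> contribute to the expansion of \<open>v\<close>. As
  \<open>v\<close> is arbitrary, this frees \<open>fcalc\<close> from the choice made in
  \<open>eigenbasis\<close>.\<close>

lemma fcalc_eigenvector:
  assumes A: "selfadjoint A" and v: "A v = \<mu> *\<^sub>R v"
  shows "fcalc \<phi> A v = \<phi> \<mu> *\<^sub>R v"
proof -
  note onb = orthonormal_eigenbasis[OF A]
  have "\<phi> (b \<bullet> A b) *\<^sub>R (b \<bullet> v) *\<^sub>R b = \<phi> \<mu> *\<^sub>R (b \<bullet> v) *\<^sub>R b" if b: "b \<in> eigenbasis A" for b
  proof (cases "b \<bullet> v = 0")
    case False
    have "(b \<bullet> A b) * (b \<bullet> v) = A b \<bullet> v"
      using eigenbasis_eigenvector[OF A b] by (metis inner_scaleR_left)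
    also have "\<dots> = \<mu> * (b \<bullet> v)" by (simp add: selfadjointD[OF A] v)
    finally show ?thesis using False by simp
  qed simp
  then have "fcalc \<phi> A v = \<phi> \<mu> *\<^sub>R (\<Sum>b\<in>eigenbasis A. (b \<bullet> v) *\<^sub>R b)"
    unfolding fcalc_def scaleR_sum_right by (intro sum.cong) auto
  then show ?thesis by (simp add: orthonormal_basis_expansion[OF onb])
qed

lemma fcalc_eigenbasis:
  assumes "selfadjoint A" "b \<in> eigenbasis A"
  shows "fcalc \<phi> A b = \<phi> (b \<bullet> A b) *\<^sub>R b"
  by (rule fcalc_eigenvector[OF assms(1) eigenbasis_eigenvector[OF assms]])

lemma linear_eq_on_orthonormal_basis:
  assumes "linear f" "linear g" "orthonormal_basis B" "\<And>b. b \<in> B \<Longrightarrow> f b = g b"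
  shows "f v = g v"
  using linear_eq_on[OF assms(1,2), of v B] assms(3,4) by (auto simp: orthonormal_basis_def)

text \<open>The chosen eigenbases of \<open>A\<close> and of its negative may be unrelated, so both
  sides are compared on that of \<open>A\<close>, whose members are eigenvectors of both
  operators.\<close>

lemma fcalc_uminus:
  assumes A: "selfadjoint A" and odd: "\<And>x. \<phi> (- x) = - \<phi> x"
  shows "fcalc \<phi> (\<lambda>v. - A v) v = - fcalc \<phi> A v"
proof (rule linear_eq_on_orthonormal_basis[where f = "fcalc \<phi> (\<lambda>v. - A v)"
      and g = "\<lambda>v. - fcalc \<phi> A v", OF _ _ orthonormal_eigenbasis[OF A]])
  show "linear (fcalc \<phi> (\<lambda>v. - A v))" by (intro selfadjoint_linear selfadjoint_fcalc)
  show "linear (\<lambda>v. - fcalc \<phi> A v)"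
    by (rule selfadjoint_linear[OF selfadjoint_uminus[OF selfadjoint_fcalc]])
  fix b assume b: "b \<in> eigenbasis A"
  have "- A b = (- (b \<bullet> A b)) *\<^sub>R b" using eigenbasis_eigenvector[OF A b] by simp
  from fcalc_eigenvector[OF selfadjoint_uminus[OF A] this, of \<phi>]
  show "fcalc \<phi> (\<lambda>v. - A v) b = - fcalc \<phi> A b"
    by (simp add: fcalc_eigenbasis[OF A b] odd)
qed

text \<open>Basis independence of the Hilbert-Schmidt norm: both sides expand to the sum of all
  \<open>(c \<bullet> A b)\<^sup>2\<close>, and \<open>A\<close> is symmetric.\<close>

lemma sum_norm2_basis_eq:
  assumes A: "selfadjoint A" and "orthonormal_basis B" "orthonormal_basis C"
  shows "(\<Sum>b\<in>B. (norm (A b))\<^sup>2) = (\<Sum>c\<in>C. (norm (A c))\<^sup>2)"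
proof -
  have sym: "c \<bullet> A b = b \<bullet> A c" for b c
    by (metis selfadjointD[OF A] inner_commute)
  have "(\<Sum>b\<in>B. (norm (A b))\<^sup>2) = (\<Sum>b\<in>B. \<Sum>c\<in>C. (c \<bullet> A b)\<^sup>2)"
    by (simp add: orthonormal_basis_norm[OF assms(3)])
  also have "\<dots> = (\<Sum>c\<in>C. \<Sum>b\<in>B. (b \<bullet> A c)\<^sup>2)"
    by (subst sum.swap) (simp only: sym)
  also have "\<dots> = (\<Sum>c\<in>C. (norm (A c))\<^sup>2)"
    by (simp add: orthonormal_basis_norm[OF assms(2)])
  finally show ?thesis .
qed

text \<open>The trace of a square is a squared Hilbert-Schmidt norm, which may be computed in a
  basis common to all operators under consideration.\<close>

lemma trf_power2:
  assumes A: "selfadjoint A" and B: "orthonormal_basis B"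
  shows "trf (\<lambda>x. (\<phi> x)\<^sup>2) A = (\<Sum>b\<in>B. (norm (fcalc \<phi> A b))\<^sup>2)"
proof -
  note onb = orthonormal_eigenbasis[OF A]
  have "(\<Sum>b\<in>B. (norm (fcalc \<phi> A b))\<^sup>2) = (\<Sum>b\<in>eigenbasis A. (norm (fcalc \<phi> A b))\<^sup>2)"
    by (rule sum_norm2_basis_eq[OF selfadjoint_fcalc B onb])
  also have "\<dots> = trf (\<lambda>x. (\<phi> x)\<^sup>2) A"
    unfolding trf_def using onb
    by (intro sum.cong) (auto simp: fcalc_eigenbasis[OF A] power_mult_distrib orthonormal_basis_def)
  finally show ?thesis by simp
qed

text \<open>Basis independence of the trace; it allows traces of different operators to be compared
  although their chosen eigenbases differ.\<close>

lemma trf_eq_sum_inner: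
  assumes A: "selfadjoint A" and B: "orthonormal_basis B"
  shows "trf \<phi> A = (\<Sum>b\<in>B. b \<bullet> fcalc \<phi> A b)"
proof -
  note onb = orthonormal_eigenbasis[OF A]
  have "(\<Sum>b\<in>B. b \<bullet> fcalc \<phi> A b) = (\<Sum>b\<in>B. \<Sum>c\<in>eigenbasis A. \<phi> (c \<bullet> A c) * (b \<bullet> c)\<^sup>2)"
    by (simp add: fcalc_def inner_sum_right power2_eq_square mult_ac inner_commute)
  also have "\<dots> = (\<Sum>c\<in>eigenbasis A. \<phi> (c \<bullet> A c) * (norm c)\<^sup>2)"
    by (subst sum.swap) (simp add: orthonormal_basis_norm[OF B] sum_distrib_left)
  also have "\<dots> = trf \<phi> A"
    unfolding trf_def using onb by (intro sum.cong) (auto simp: orthonormal_basis_def)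
  finally show ?thesis by simp
qed

text \<open>Jensen's inequality for the spectral distribution of \<open>v\<close>: the weights
  \<open>(b \<bullet> v)\<^sup>2\<close> on the eigenvalues add up to 1.\<close>

lemma convex_on_inner_le_fcalc:
  assumes A: "selfadjoint A" and \<phi>: "convex_on UNIV \<phi>" and v: "norm v = 1"
  shows "\<phi> (v \<bullet> A v) \<le> v \<bullet> fcalc \<phi> A v"
proof -
  note onb = orthonormal_eigenbasis[OF A]
  have s: "(\<Sum>b\<in>eigenbasis A. (b \<bullet> v)\<^sup>2) = 1"
    using orthonormal_basis_norm[OF onb, of v] v by simp
  have ne: "eigenbasis A \<noteq> {}" using s by auto
  have "b \<bullet> A v = (b \<bullet> A b) * (b \<bullet> v)" if "b \<in> eigenbasis A" for b
    using eigenbasis_eigenvector[OF A that] selfadjointD[OF A, of b v] by (metis inner_scaleR_left)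
  then have "v \<bullet> A v = (\<Sum>b\<in>eigenbasis A. (b \<bullet> v)\<^sup>2 * (b \<bullet> A b))"
    unfolding orthonormal_basis_inner[OF onb, of v "A v"]
    by (intro sum.cong) (auto simp: power2_eq_square)
  also have "\<phi> \<dots> \<le> (\<Sum>b\<in>eigenbasis A. (b \<bullet> v)\<^sup>2 * \<phi> (b \<bullet> A b))"
    using convex_on_sum[OF orthonormal_basis_finite[OF onb] ne \<phi> s, of "\<lambda>b. b \<bullet> A b"] by simp
  also have "\<dots> = v \<bullet> fcalc \<phi> A v"
    by (simp add: fcalc_def inner_sum_right power2_eq_square mult_ac inner_commute)
  finally show ?thesis .
qed

text \<open>Between the two eigenbases, the difference of the two functions has the entries
  \<open>(\<phi> (a \<bullet> A a) - \<phi> (b \<bullet> B b)) * (a \<bullet> b)\<close>.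
  Noncommuting operators are thereby compared through scalar inequalities between pairs of
  eigenvalues.\<close>

lemma sum_norm2_fcalc_diff:
  assumes A: "selfadjoint A" and B: "selfadjoint B" and E: "orthonormal_basis E"
  shows "(\<Sum>e\<in>E. (norm (fcalc \<phi> A e - fcalc \<phi> B e))\<^sup>2)
    = (\<Sum>b\<in>eigenbasis B. \<Sum>a\<in>eigenbasis A. (\<phi> (a \<bullet> A a) - \<phi> (b \<bullet> B b))\<^sup>2 * (a \<bullet> b)\<^sup>2)"
proof -
  note onA = orthonormal_eigenbasis[OF A] and onB = orthonormal_eigenbasis[OF B]
  have "(\<Sum>e\<in>E. (norm (fcalc \<phi> A e - fcalc \<phi> B e))\<^sup>2)
      = (\<Sum>b\<in>eigenbasis B. (norm (fcalc \<phi> A b - fcalc \<phi> B b))\<^sup>2)"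
    by (rule sum_norm2_basis_eq[OF selfadjoint_diff[OF selfadjoint_fcalc selfadjoint_fcalc] E onB])
  also have "\<dots> = (\<Sum>b\<in>eigenbasis B. \<Sum>a\<in>eigenbasis A. (\<phi> (a \<bullet> A a) - \<phi> (b \<bullet> B b))\<^sup>2 * (a \<bullet> b)\<^sup>2)"
  proof (intro sum.cong refl)
    fix b assume b: "b \<in> eigenbasis B"
    have "a \<bullet> (fcalc \<phi> A b - fcalc \<phi> B b) = (\<phi> (a \<bullet> A a) - \<phi> (b \<bullet> B b)) * (a \<bullet> b)"
      if a: "a \<in> eigenbasis A" for a
      using selfadjointD[OF selfadjoint_fcalc, of \<phi> A a b]
      by (simp add: inner_diff_right fcalc_eigenbasis[OF A a] fcalc_eigenbasis[OF B b] algebra_simps)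
    then show "(norm (fcalc \<phi> A b - fcalc \<phi> B b))\<^sup>2
        = (\<Sum>a\<in>eigenbasis A. (\<phi> (a \<bullet> A a) - \<phi> (b \<bullet> B b))\<^sup>2 * (a \<bullet> b)\<^sup>2)"
      unfolding orthonormal_basis_norm[OF onA] by (simp add: power_mult_distrib)
  qed
  finally show ?thesis .
qed

text \<open>The same expansion for \<open>A - B\<close> itself, with a weight depending on the
  eigenvalue of \<open>A\<close>; it serves to read a scalar bound back as a statement on
  operators.\<close>

lemma sum_weighted_norm2_diff:
  assumes A: "selfadjoint A" and B: "selfadjoint B"
  shows "(\<Sum>a\<in>eigenbasis A. \<psi> (a \<bullet> A a) * (norm (A a - B a))\<^sup>2)
    = (\<Sum>b\<in>eigenbasis B. \<Sum>a\<in>eigenbasis A. \<psi> (a \<bullet> A a) * ((a \<bullet> A a) - (b \<bullet> B b))\<^sup>2 * (a \<bullet> b)\<^sup>2)"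
proof -
  note onA = orthonormal_eigenbasis[OF A] and onB = orthonormal_eigenbasis[OF B]
  have "(norm (A a - B a))\<^sup>2 = (\<Sum>b\<in>eigenbasis B. ((a \<bullet> A a) - (b \<bullet> B b))\<^sup>2 * (a \<bullet> b)\<^sup>2)"
    if a: "a \<in> eigenbasis A" for a
  proof -
    have "b \<bullet> (A a - B a) = ((a \<bullet> A a) - (b \<bullet> B b)) * (a \<bullet> b)" if b: "b \<in> eigenbasis B" for b
    proof -
      have "b \<bullet> A a = (a \<bullet> A a) * (a \<bullet> b)"
        by (subst eigenbasis_eigenvector[OF A a]) (simp add: inner_commute)
      moreover have "b \<bullet> B a = (b \<bullet> B b) * (a \<bullet> b)"
        by (subst selfadjointD[OF B, symmetric], subst eigenbasis_eigenvector[OF B b])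
           (simp add: inner_commute)
      ultimately show ?thesis by (simp add: inner_diff_right algebra_simps)
    qed
    then show ?thesis
      unfolding orthonormal_basis_norm[OF onB] by (simp add: power_mult_distrib)
  qed
  then show ?thesis
    by (subst sum.swap) (simp add: sum_distrib_left mult.assoc)
qed

section \<open>Differences of hyperbolic sines, for numbers and for operators\<close>

lemma abs_sinh_le_mult_cosh:
  fixes h :: real
  shows "\<bar>sinh h\<bar> \<le> \<bar>h\<bar> * cosh h"
proof -
  have pos: "sinh h \<le> h * cosh h" if "h > 0" for h :: real
  proof -
    have "\<exists>z>0. z < h \<and> sinh h - sinh 0 = (h - 0) * cosh z"
      by (rule MVT2) (use that in \<open>auto intro!: derivative_eq_intros\<close>)
    then obtain z where z: "0 < z" "z < h" "sinh h - sinh 0 = (h - 0) * cosh z"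
      by blast
    then have "sinh h = h * cosh z" by simp
    also have "\<dots> \<le> h * cosh h"
      using z by (intro mult_left_mono) (auto simp: cosh_real_nonneg_le_iff)
    finally show ?thesis .
  qed
  show ?thesis
    using pos[of h] pos[of "- h"] by (cases h "0::real" rule: linorder_cases) auto
qed

text \<open>With midpoint \<open>u\<close> and half difference \<open>h\<close>, the left side is
  \<open>4 * (cosh u)\<^sup>2 * (sinh h)\<^sup>2\<close>, while the squares of \<open>cosh x\<close>
  and \<open>cosh y\<close> add up to twice \<open>(cosh u)\<^sup>2 * (cosh h)\<^sup>2 + (sinh
  u)\<^sup>2 * (sinh h)\<^sup>2\<close>.\<close>

lemma sinh_diff_le_cosh:
  fixes x y :: real
  shows "(sinh x - sinh y)\<^sup>2 \<le> ((cosh x)\<^sup>2 + (cosh y)\<^sup>2) / 2 * (x - y)\<^sup>2"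
proof -
  define u h where "u = (x + y) / 2" and "h = (x - y) / 2"
  have xy: "x = u + h" "y = u - h" by (auto simp: u_def h_def field_simps)
  have h2: "(sinh h)\<^sup>2 \<le> h\<^sup>2 * (cosh h)\<^sup>2"
    using power_mono[OF abs_sinh_le_mult_cosh, of h 2] by (simp add: power_mult_distrib)
  have "(sinh x - sinh y)\<^sup>2 = 4 * (cosh u)\<^sup>2 * (sinh h)\<^sup>2"
    by (simp add: xy sinh_add sinh_diff power2_eq_square algebra_simps)
  also have "\<dots> \<le> 4 * (cosh u)\<^sup>2 * (h\<^sup>2 * (cosh h)\<^sup>2)"
    using h2 by (intro mult_left_mono) auto
  also have "\<dots> \<le> 4 * h\<^sup>2 * ((cosh u)\<^sup>2 * (cosh h)\<^sup>2 + (sinh u)\<^sup>2 * (sinh h)\<^sup>2)"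
    by (simp add: algebra_simps)
  also have "\<dots> = ((cosh x)\<^sup>2 + (cosh y)\<^sup>2) / 2 * (x - y)\<^sup>2"
    by (simp add: xy cosh_add cosh_diff power2_eq_square algebra_simps)
  finally show ?thesis .
qed

text \<open>The scalar bound is applied to each pair of eigenvalues. Of its two terms, one is summed
  back over the eigenbasis of \<open>A\<close> and the other over that of \<open>B\<close>, so each
  \<open>cosh\<close> weight meets only its own eigenvectors.\<close>

lemma sum_norm2_sinh_diff_le:
  assumes A: "selfadjoint A" and B: "selfadjoint B" and E: "orthonormal_basis E"
  shows "(\<Sum>e\<in>E. (norm (fcalc sinh A e - fcalc sinh B e))\<^sup>2)
    \<le> ((\<Sum>a\<in>eigenbasis A. (cosh (a \<bullet> A a))\<^sup>2 * (norm (A a - B a))\<^sup>2)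
        + (\<Sum>b\<in>eigenbasis B. (cosh (b \<bullet> B b))\<^sup>2 * (norm (B b - A b))\<^sup>2)) / 2"
proof -
  let ?l = "\<lambda>a. a \<bullet> A a" and ?m = "\<lambda>b. b \<bullet> B b"
  have 2: "(\<Sum>b\<in>eigenbasis B. (cosh (?m b))\<^sup>2 * (norm (B b - A b))\<^sup>2)
     = (\<Sum>b\<in>eigenbasis B. \<Sum>a\<in>eigenbasis A. (cosh (?m b))\<^sup>2 * (?l a - ?m b)\<^sup>2 * (a \<bullet> b)\<^sup>2)"
    unfolding sum_weighted_norm2_diff[OF B A, where \<psi> = "\<lambda>x. (cosh x)\<^sup>2"]
    by (subst sum.swap) (simp add: power2_commute inner_commute)
  have "(\<Sum>e\<in>E. (norm (fcalc sinh A e - fcalc sinh B e))\<^sup>2)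
    = (\<Sum>b\<in>eigenbasis B. \<Sum>a\<in>eigenbasis A. (sinh (?l a) - sinh (?m b))\<^sup>2 * (a \<bullet> b)\<^sup>2)"
    by (rule sum_norm2_fcalc_diff[OF assms])
  also have "\<dots> \<le> (\<Sum>b\<in>eigenbasis B. \<Sum>a\<in>eigenbasis A.
      ((cosh (?l a))\<^sup>2 * (?l a - ?m b)\<^sup>2 * (a \<bullet> b)\<^sup>2 + (cosh (?m b))\<^sup>2 * (?l a - ?m b)\<^sup>2 * (a \<bullet> b)\<^sup>2) / 2)"
    (is "_ \<le> (\<Sum>b\<in>_. \<Sum>a\<in>_. ?R a b)")
  proof (intro sum_mono)
    fix a b
    have "(sinh (?l a) - sinh (?m b))\<^sup>2 * (a \<bullet> b)\<^sup>2
        \<le> (cosh (?l a) ^ 2 + cosh (?m b) ^ 2) / 2 * (?l a - ?m b)\<^sup>2 * (a \<bullet> b)\<^sup>2"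
      by (intro mult_right_mono sinh_diff_le_cosh) auto
    then show "(sinh (?l a) - sinh (?m b))\<^sup>2 * (a \<bullet> b)\<^sup>2 \<le> ?R a b"
      by (simp add: algebra_simps add_divide_distrib)
  qed
  finally show ?thesis
    unfolding 2 sum_weighted_norm2_diff[OF A B, where \<psi> = "\<lambda>x. (cosh x)\<^sup>2"]
    by (simp add: sum.distrib sum_divide_distrib[symmetric] add_divide_distrib)
qed

subsection \<open>Odd functions under commuting involutions\<close>

lemma parallelogram_identity:
  fixes v w :: "'a::real_inner"
  shows "(norm (v + w))\<^sup>2 + (norm (v - w))\<^sup>2 = 2 * ((norm v)\<^sup>2 + (norm w)\<^sup>2)"
  by (simp add: power2_norm_eq_inner algebra_simps inner_commute)

lemma norm_add_power2_le:
  fixes v w :: "'a::real_inner"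
  shows "(norm (v + w))\<^sup>2 \<le> 2 * ((norm v)\<^sup>2 + (norm w)\<^sup>2)"
  using parallelogram_identity[of v w] zero_le_power2[of "norm (v - w)"] by linarith

text \<open>A weighted substitute for the discrete cube: the \<open>\<tau> s\<close> act as sign
  flips and \<open>T\<close> as the flip of all signs. Fixed points are allowed, and the list in
  \<open>T_generated\<close> may depend on the point.\<close>

locale commuting_involutions =
  fixes \<Omega> :: "'w set" and W :: "'w \<Rightarrow> real" and k :: nat
    and \<tau> :: "nat \<Rightarrow> 'w \<Rightarrow> 'w" and T :: "'w \<Rightarrow> 'w"
  assumes finite: "finite \<Omega>"
    and W_nonneg: "\<omega> \<in> \<Omega> \<Longrightarrow> 0 \<le> W \<omega>"
    and \<tau>_mem: "s < k \<Longrightarrow> \<omega> \<in> \<Omega> \<Longrightarrow> \<tau> s \<omega> \<in> \<Omega>"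
    and \<tau>_\<tau>: "s < k \<Longrightarrow> \<omega> \<in> \<Omega> \<Longrightarrow> \<tau> s (\<tau> s \<omega>) = \<omega>"
    and \<tau>_commute: "s < k \<Longrightarrow> r < k \<Longrightarrow> \<omega> \<in> \<Omega> \<Longrightarrow> \<tau> s (\<tau> r \<omega>) = \<tau> r (\<tau> s \<omega>)"
    and W_\<tau>: "s < k \<Longrightarrow> \<omega> \<in> \<Omega> \<Longrightarrow> W (\<tau> s \<omega>) = W \<omega>"
    and T_mem: "\<omega> \<in> \<Omega> \<Longrightarrow> T \<omega> \<in> \<Omega>"
    and T_T: "\<omega> \<in> \<Omega> \<Longrightarrow> T (T \<omega>) = \<omega>"
    and T_\<tau>: "s < k \<Longrightarrow> \<omega> \<in> \<Omega> \<Longrightarrow> T (\<tau> s \<omega>) = \<tau> s (T \<omega>)"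
    and W_T: "\<omega> \<in> \<Omega> \<Longrightarrow> W (T \<omega>) = W \<omega>"
    and T_generated: "\<omega> \<in> \<Omega> \<Longrightarrow>
      (\<exists>ss. set ss \<subseteq> {..<k} \<and> T \<omega> = fold \<tau> ss \<omega>)"
begin

lemma sum_\<tau>:
  fixes F :: "'w \<Rightarrow> real"
  assumes "s < k"
  shows "(\<Sum>\<omega>\<in>\<Omega>. W \<omega> * F (\<tau> s \<omega>)) = (\<Sum>\<omega>\<in>\<Omega>. W \<omega> * F \<omega>)"
  by (rule sum.reindex_bij_witness[of _ "\<tau> s" "\<tau> s"])
     (use assms in \<open>auto simp: \<tau>_mem \<tau>_\<tau> W_\<tau>\<close>)

lemma sum_W_half:
  "(\<Sum>\<omega>\<in>\<Omega>. W \<omega> * ((F \<omega> + G \<omega>) / 2)) = ((\<Sum>\<omega>\<in>\<Omega>. W \<omega> * F \<omega>) + (\<Sum>\<omega>\<in>\<Omega>. W \<omega> * G \<omega>)) / 2"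
  by (simp add: sum.distrib[symmetric] sum_divide_distrib distrib_left add_divide_distrib)

lemma T_invariant:
  assumes h: "\<And>s \<omega>. s < k \<Longrightarrow> \<omega> \<in> \<Omega> \<Longrightarrow> h (\<tau> s \<omega>) = h \<omega>" and "\<omega> \<in> \<Omega>"
  shows "h (T \<omega>) = h \<omega>"
proof -
  have "h (fold \<tau> ss \<omega>) = h \<omega>" if "set ss \<subseteq> {..<k}" for ss
    using that \<open>\<omega> \<in> \<Omega>\<close> by (induction ss arbitrary: \<omega>) (auto simp: \<tau>_mem h)
  then show ?thesis using T_generated[OF \<open>\<omega> \<in> \<Omega>\<close>] by auto
qed

text \<open>
  Averaging over one involution after the other splits off one orthogonal increment per step.
  The last average is invariant under all the involutions, hence under \<open>T\<close>, so it vanishes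
  for odd \<open>g\<close>.
\<close>

primrec average :: "('w \<Rightarrow> 'b::real_inner) \<Rightarrow> nat \<Rightarrow> 'w \<Rightarrow> 'b" where
  "average g 0 \<omega> = g \<omega>"
| "average g (Suc m) \<omega> = (1 / 2) *\<^sub>R (average g m \<omega> + average g m (\<tau> m \<omega>))"

lemma average_invariant:
  "m \<le> k \<Longrightarrow> s < m \<Longrightarrow> \<omega> \<in> \<Omega> \<Longrightarrow> average g m (\<tau> s \<omega>) = average g m \<omega>"
proof (induction m arbitrary: \<omega>)
  case (Suc m)
  show ?case
  proof (cases "s = m")
    case True
    then show ?thesis using Suc.prems by (simp add: \<tau>_\<tau> add.commute)
  next
    case False
    then have "s < m" using Suc.prems by simp
    then show ?thesis
      using Suc.prems Suc.IH[of \<omega>] Suc.IH[of "\<tau> m \<omega>"] \<tau>_commute[of m s \<omega>] \<tau>_mem[of m \<omega>]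
      by simp
  qed
qed simp

lemma average_odd:
  assumes "\<And>\<omega>. \<omega> \<in> \<Omega> \<Longrightarrow> g (T \<omega>) = - g \<omega>"
  shows "m \<le> k \<Longrightarrow> \<omega> \<in> \<Omega> \<Longrightarrow> average g m (T \<omega>) = - average g m \<omega>"
proof (induction m arbitrary: \<omega>)
  case (Suc m)
  then show ?case
    using Suc.IH[of \<omega>] Suc.IH[of "\<tau> m \<omega>"] T_\<tau>[of m \<omega>] \<tau>_mem[of m \<omega>]
    by (simp flip: scaleR_minus_right)
qed (simp add: assms)

text \<open>Averaging contracts increments: by commutation the increment of an average is the
  average of two increments, the squared norm is convex, and the weight is invariant.\<close>

lemma average_increment_le:
  fixes g :: "'w \<Rightarrow> 'b::real_inner"
  assumes "m \<le> k" "s < k"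
  shows "(\<Sum>\<omega>\<in>\<Omega>. W \<omega> * (norm (average g m \<omega> - average g m (\<tau> s \<omega>)))\<^sup>2)
    \<le> (\<Sum>\<omega>\<in>\<Omega>. W \<omega> * (norm (g \<omega> - g (\<tau> s \<omega>)))\<^sup>2)"
  using assms(1)
proof (induction m)
  case (Suc m)
  let ?h = "average g m"
  let ?D = "\<lambda>\<omega>. ?h \<omega> - ?h (\<tau> s \<omega>)"
  have m: "m < k" using Suc.prems by simp
  have "(norm (average g (Suc m) \<omega> - average g (Suc m) (\<tau> s \<omega>)))\<^sup>2
      \<le> ((norm (?D \<omega>))\<^sup>2 + (norm (?D (\<tau> m \<omega>)))\<^sup>2) / 2" if "\<omega> \<in> \<Omega>" for \<omega>
  proof -
    have "average g (Suc m) \<omega> - average g (Suc m) (\<tau> s \<omega>) = (1 / 2) *\<^sub>R (?D \<omega> + ?D (\<tau> m \<omega>))"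
      using \<tau>_commute[OF m \<open>s < k\<close> that] by (simp add: algebra_simps)
    moreover have "(norm (?D \<omega> + ?D (\<tau> m \<omega>)))\<^sup>2 \<le> 2 * ((norm (?D \<omega>))\<^sup>2 + (norm (?D (\<tau> m \<omega>)))\<^sup>2)"
      by (rule norm_add_power2_le)
    ultimately show ?thesis by (simp only: norm_scaleR power_mult_distrib) (simp add: power_divide)
  qed
  then have "(\<Sum>\<omega>\<in>\<Omega>. W \<omega> * (norm (average g (Suc m) \<omega> - average g (Suc m) (\<tau> s \<omega>)))\<^sup>2)
      \<le> (\<Sum>\<omega>\<in>\<Omega>. W \<omega> * (((norm (?D \<omega>))\<^sup>2 + (norm (?D (\<tau> m \<omega>)))\<^sup>2) / 2))"
    by (intro sum_mono mult_left_mono W_nonneg)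
  also have "\<dots> = ((\<Sum>\<omega>\<in>\<Omega>. W \<omega> * (norm (?D \<omega>))\<^sup>2) + (\<Sum>\<omega>\<in>\<Omega>. W \<omega> * (norm (?D (\<tau> m \<omega>)))\<^sup>2)) / 2"
    by (rule sum_W_half)
  also have "\<dots> = (\<Sum>\<omega>\<in>\<Omega>. W \<omega> * (norm (?D \<omega>))\<^sup>2)"
    using sum_\<tau>[OF m, of "\<lambda>\<omega>. (norm (?D \<omega>))\<^sup>2"] by simp
  also have "\<dots> \<le> (\<Sum>\<omega>\<in>\<Omega>. W \<omega> * (norm (g \<omega> - g (\<tau> s \<omega>)))\<^sup>2)"
    using Suc by simp
  finally show ?case .
qed simp

text \<open>Pythagoras for the splitting of a function into its even and odd parts under
  \<open>\<tau> m\<close>. The odd part is half the increment, whence the factor 1/4.\<close>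

lemma average_step:
  assumes m: "m < k"
  shows "(\<Sum>\<omega>\<in>\<Omega>. W \<omega> * (norm (average g m \<omega>))\<^sup>2)
    = (\<Sum>\<omega>\<in>\<Omega>. W \<omega> * (norm (average g (Suc m) \<omega>))\<^sup>2)
      + (\<Sum>\<omega>\<in>\<Omega>. W \<omega> * (norm (average g m \<omega> - average g m (\<tau> m \<omega>)))\<^sup>2) / 4"
proof -
  let ?h = "average g m"
  have "(norm (average g (Suc m) \<omega>))\<^sup>2 + (norm (?h \<omega> - ?h (\<tau> m \<omega>)))\<^sup>2 / 4
      = ((norm (?h \<omega>))\<^sup>2 + (norm (?h (\<tau> m \<omega>)))\<^sup>2) / 2" for \<omega>
    using parallelogram_identity[of "?h \<omega>" "?h (\<tau> m \<omega>)"] by (simp add: power_divide)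
  then have "(\<Sum>\<omega>\<in>\<Omega>. W \<omega> * ((norm (average g (Suc m) \<omega>))\<^sup>2 + (norm (?h \<omega> - ?h (\<tau> m \<omega>)))\<^sup>2 / 4))
      = ((\<Sum>\<omega>\<in>\<Omega>. W \<omega> * (norm (?h \<omega>))\<^sup>2) + (\<Sum>\<omega>\<in>\<Omega>. W \<omega> * (norm (?h (\<tau> m \<omega>)))\<^sup>2)) / 2"
    by (simp add: sum.distrib[symmetric] sum_divide_distrib distrib_left add_divide_distrib)
  also have "\<dots> = (\<Sum>\<omega>\<in>\<Omega>. W \<omega> * (norm (?h \<omega>))\<^sup>2)"
    using sum_\<tau>[OF m, of "\<lambda>\<omega>. (norm (?h \<omega>))\<^sup>2"] by simp
  finally show ?thesis
    by (simp add: sum.distrib distrib_left sum_divide_distrib)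
qed

text \<open>Telescopes \<open>average_step\<close> and bounds each increment of an average by the
  corresponding increment of \<open>g\<close>.\<close>

lemma poincare_odd:
  fixes g :: "'w \<Rightarrow> 'b::real_inner"
  assumes odd: "\<And>\<omega>. \<omega> \<in> \<Omega> \<Longrightarrow> g (T \<omega>) = - g \<omega>"
  shows "(\<Sum>\<omega>\<in>\<Omega>. W \<omega> * (norm (g \<omega>))\<^sup>2)
    \<le> (\<Sum>s<k. \<Sum>\<omega>\<in>\<Omega>. W \<omega> * (norm (g \<omega> - g (\<tau> s \<omega>)))\<^sup>2) / 4"
proof -
  let ?I = "\<lambda>s. \<Sum>\<omega>\<in>\<Omega>. W \<omega> * (norm (g \<omega> - g (\<tau> s \<omega>)))\<^sup>2"
  have "(\<Sum>\<omega>\<in>\<Omega>. W \<omega> * (norm (g \<omega>))\<^sup>2)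
      \<le> (\<Sum>\<omega>\<in>\<Omega>. W \<omega> * (norm (average g m \<omega>))\<^sup>2) + (\<Sum>s<m. ?I s) / 4" if "m \<le> k" for m
    using that
  proof (induction m)
    case (Suc m)
    then show ?case
      using average_step[of m g] average_increment_le[of m m g] by (simp add: add_divide_distrib)
  qed simp
  moreover have "average g k \<omega> = 0" if "\<omega> \<in> \<Omega>" for \<omega>
  proof -
    have "average g k \<omega> = average g k (T \<omega>)"
      by (rule T_invariant[symmetric]) (auto simp: average_invariant that)
    also have "average g k (T \<omega>) = - average g k \<omega>"
      using average_odd[where g = g, OF odd, of k \<omega>] that by simp
    finally have "average g k \<omega> + average g k \<omega> = 0"
      by (metis add.left_inverse)
    then show ?thesis by (simp flip: scaleR_2)
  qed
  ultimately show ?thesis by force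
qed

text \<open>The Poincare inequality is applied to the vector-valued functions obtained by letting
  \<open>sinh\<close> of the operator act on each \<open>e\<close> in \<open>Basis\<close>; their
  sum is the Hilbert-Schmidt norm. Its factor 1/4 absorbs the 4 in the assumed bound.\<close>

lemma trf_sinh_le:
  fixes A :: "'w \<Rightarrow> 'a::euclidean_space \<Rightarrow> 'a"
  assumes A: "\<And>\<omega>. \<omega> \<in> \<Omega> \<Longrightarrow> selfadjoint (A \<omega>)"
    and odd: "\<And>\<omega>. \<omega> \<in> \<Omega> \<Longrightarrow> A (T \<omega>) = (\<lambda>v. - A \<omega> v)"
    and bound: "\<And>\<omega> v. \<omega> \<in> \<Omega> \<Longrightarrow> norm v = 1 \<Longrightarrow> (\<Sum>s<k. (norm (A \<omega> v - A (\<tau> s \<omega>) v))\<^sup>2) \<le> 4 * b"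
  shows "(\<Sum>\<omega>\<in>\<Omega>. W \<omega> * trf (\<lambda>x. (sinh x)\<^sup>2) (A \<omega>))
    \<le> b * (\<Sum>\<omega>\<in>\<Omega>. W \<omega> * trf (\<lambda>x. (cosh x)\<^sup>2) (A \<omega>))"
proof -
  let ?g = "\<lambda>\<omega>. fcalc sinh (A \<omega>)"
  define c where "c s \<omega> = (\<Sum>a\<in>eigenbasis (A \<omega>). (cosh (a \<bullet> A \<omega> a))\<^sup>2 * (norm (A \<omega> a - A (\<tau> s \<omega>) a))\<^sup>2)"
    for s \<omega>
  have "(\<Sum>\<omega>\<in>\<Omega>. W \<omega> * trf (\<lambda>x. (sinh x)\<^sup>2) (A \<omega>))
      = (\<Sum>\<omega>\<in>\<Omega>. \<Sum>e\<in>Basis. W \<omega> * (norm (?g \<omega> e))\<^sup>2)"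
    by (intro sum.cong refl) (simp add: trf_power2[OF A orthonormal_basis_Basis] sum_distrib_left)
  also have "\<dots> = (\<Sum>e\<in>Basis. \<Sum>\<omega>\<in>\<Omega>. W \<omega> * (norm (?g \<omega> e))\<^sup>2)"
    by (rule sum.swap)
  also have "\<dots> \<le> (\<Sum>e\<in>Basis. (\<Sum>s<k. \<Sum>\<omega>\<in>\<Omega>. W \<omega> * (norm (?g \<omega> e - ?g (\<tau> s \<omega>) e))\<^sup>2) / 4)"
    by (intro sum_mono poincare_odd) (simp add: odd fcalc_uminus A)
  also have "\<dots> = (\<Sum>s<k. \<Sum>\<omega>\<in>\<Omega>. W \<omega> * (\<Sum>e\<in>Basis. (norm (?g \<omega> e - ?g (\<tau> s \<omega>) e))\<^sup>2)) / 4"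
    unfolding sum_distrib_left sum_divide_distrib[symmetric]
    by (subst sum.swap, subst (2) sum.swap) (rule refl)
  also have "\<dots> \<le> (\<Sum>s<k. \<Sum>\<omega>\<in>\<Omega>. W \<omega> * ((c s \<omega> + c s (\<tau> s \<omega>)) / 2)) / 4"
  proof (intro divide_right_mono sum_mono mult_left_mono W_nonneg)
    fix s \<omega> assume s: "s \<in> {..<k}" and \<omega>: "\<omega> \<in> \<Omega>"
    show "(\<Sum>e\<in>Basis. (norm (?g \<omega> e - ?g (\<tau> s \<omega>) e))\<^sup>2) \<le> (c s \<omega> + c s (\<tau> s \<omega>)) / 2"
      using sum_norm2_sinh_diff_le[OF A[OF \<omega>] A[OF \<tau>_mem] orthonormal_basis_Basis, of s] s \<omega>
      by (simp add: c_def \<tau>_\<tau>)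
  qed auto
  also have "\<dots> = (\<Sum>s<k. ((\<Sum>\<omega>\<in>\<Omega>. W \<omega> * c s \<omega>) + (\<Sum>\<omega>\<in>\<Omega>. W \<omega> * c s (\<tau> s \<omega>))) / 2) / 4"
    by (simp only: sum_W_half)
  \<comment> \<open>The two \<open>cosh\<close> terms have the same weighted sum, by the change of
    variables \<open>\<tau> s\<close>.\<close>
  also have "\<dots> = (\<Sum>s<k. \<Sum>\<omega>\<in>\<Omega>. W \<omega> * c s \<omega>) / 4"
  proof -
    have "((\<Sum>\<omega>\<in>\<Omega>. W \<omega> * c s \<omega>) + (\<Sum>\<omega>\<in>\<Omega>. W \<omega> * c s (\<tau> s \<omega>))) / 2 = (\<Sum>\<omega>\<in>\<Omega>. W \<omega> * c s \<omega>)"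
      if "s < k" for s
      using sum_\<tau>[OF that, of "c s"] by simp
    then show ?thesis by simp
  qed
  also have "\<dots> = (\<Sum>\<omega>\<in>\<Omega>. W \<omega> * (\<Sum>a\<in>eigenbasis (A \<omega>). (cosh (a \<bullet> A \<omega> a))\<^sup>2 *
      (\<Sum>s<k. (norm (A \<omega> a - A (\<tau> s \<omega>) a))\<^sup>2))) / 4"
    unfolding c_def sum_distrib_left by (subst sum.swap, subst (2) sum.swap) (simp add: mult_ac)
  also have "\<dots> \<le> (\<Sum>\<omega>\<in>\<Omega>. W \<omega> * (\<Sum>a\<in>eigenbasis (A \<omega>). (cosh (a \<bullet> A \<omega> a))\<^sup>2 * (4 * b))) / 4"
    using orthonormal_eigenbasis[OF A]
    by (intro divide_right_mono sum_mono mult_left_mono W_nonneg bound) (auto simp: orthonormal_basis_def)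
  also have "\<dots> = b * (\<Sum>\<omega>\<in>\<Omega>. W \<omega> * trf (\<lambda>x. (cosh x)\<^sup>2) (A \<omega>))"
    by (simp add: trf_def sum_distrib_left sum_divide_distrib mult_ac)
  finally show ?thesis .
qed

text \<open>\<open>T\<close> preserves the weight and replaces each operator by its negative, so the
  sum equals its own negative.\<close>

lemma trf_sinh_odd:
  fixes A :: "'w \<Rightarrow> 'a::euclidean_space \<Rightarrow> 'a"
  assumes A: "\<And>\<omega>. \<omega> \<in> \<Omega> \<Longrightarrow> selfadjoint (A \<omega>)"
    and odd: "\<And>\<omega>. \<omega> \<in> \<Omega> \<Longrightarrow> A (T \<omega>) = (\<lambda>v. - A \<omega> v)"
    and \<phi>: "\<And>x. \<phi> (- x) = - \<phi> x"
  shows "(\<Sum>\<omega>\<in>\<Omega>. W \<omega> * trf \<phi> (A \<omega>)) = 0"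
proof -
  have "trf \<phi> (A (T \<omega>)) = - trf \<phi> (A \<omega>)" if "\<omega> \<in> \<Omega>" for \<omega>
    unfolding trf_eq_sum_inner[OF A[OF that] orthonormal_basis_Basis]
      trf_eq_sum_inner[OF A[OF T_mem[OF that]] orthonormal_basis_Basis]
    by (simp add: odd that fcalc_uminus A \<phi> sum_negf)
  moreover have "(\<Sum>\<omega>\<in>\<Omega>. W \<omega> * trf \<phi> (A (T \<omega>))) = (\<Sum>\<omega>\<in>\<Omega>. W \<omega> * trf \<phi> (A \<omega>))"
    by (rule sum.reindex_bij_witness[of _ T T]) (auto simp: T_mem T_T W_T)
  ultimately show ?thesis by (simp add: sum_negf)
qed

text \<open>Write \<open>exp (2 * x) = 1 + 2 * (sinh x)\<^sup>2 + sinh (2 * x)\<close>; the last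
  term averages to zero. Since \<open>(cosh x)\<^sup>2 = 1 + (sinh x)\<^sup>2\<close>, the bound of
  \<open>trf_sinh_le\<close> is a self-bounding inequality for \<open>S\<close>, solvable because
  \<open>b < 1\<close>.\<close>

lemma trf_exp_le:
  fixes A :: "'w \<Rightarrow> 'a::euclidean_space \<Rightarrow> 'a"
  assumes A: "\<And>\<omega>. \<omega> \<in> \<Omega> \<Longrightarrow> selfadjoint (A \<omega>)"
    and odd: "\<And>\<omega>. \<omega> \<in> \<Omega> \<Longrightarrow> A (T \<omega>) = (\<lambda>v. - A \<omega> v)"
    and bound: "\<And>\<omega> v. \<omega> \<in> \<Omega> \<Longrightarrow> norm v = 1 \<Longrightarrow> (\<Sum>s<k. (norm (A \<omega> v - A (\<tau> s \<omega>) v))\<^sup>2) \<le> 4 * b"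
    and b: "b < 1"
  shows "(\<Sum>\<omega>\<in>\<Omega>. W \<omega> * trf (\<lambda>x. exp (2 * x)) (A \<omega>))
    \<le> real DIM('a) * (\<Sum>\<omega>\<in>\<Omega>. W \<omega>) * (1 + 2 * b / (1 - b))"
proof -
  define K where "K = real DIM('a) * (\<Sum>\<omega>\<in>\<Omega>. W \<omega>)"
  define S where "S = (\<Sum>\<omega>\<in>\<Omega>. W \<omega> * trf (\<lambda>x. (sinh x)\<^sup>2) (A \<omega>))"
  have one: "(\<Sum>\<omega>\<in>\<Omega>. W \<omega> * trf (\<lambda>x. 1) (A \<omega>)) = K"
    using orthonormal_basis_card[OF orthonormal_eigenbasis[OF A]]
    by (simp add: K_def trf_def mult.commute flip: sum_distrib_left sum_distrib_right)
  have "(cosh x)\<^sup>2 = 1 + (sinh x)\<^sup>2" for x :: real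
    by (simp add: cosh_square_eq)
  then have "(\<Sum>\<omega>\<in>\<Omega>. W \<omega> * trf (\<lambda>x. (cosh x)\<^sup>2) (A \<omega>)) = K + S"
    unfolding one[symmetric] S_def by (simp add: trf_def sum.distrib distrib_left)
  then have "S \<le> b * (K + S)"
    using trf_sinh_le[where A = A, OF A odd bound] unfolding S_def by simp
  then have "S \<le> K * b / (1 - b)"
    using b by (simp add: field_simps)
  have "exp (2 * x) = 1 + 2 * (sinh x)\<^sup>2 + sinh (2 * x)" for x :: real
  proof -
    have "exp (2 * x) = cosh (2 * x) + sinh (2 * x)" by (simp add: cosh_plus_sinh)
    then show ?thesis using cosh_double[of x] by (simp add: cosh_square_eq)
  qed
  then have "(\<Sum>\<omega>\<in>\<Omega>. W \<omega> * trf (\<lambda>x. exp (2 * x)) (A \<omega>))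
     = K + 2 * S + (\<Sum>\<omega>\<in>\<Omega>. W \<omega> * trf (\<lambda>x. sinh (2 * x)) (A \<omega>))"
    unfolding one[symmetric] S_def
    by (simp add: trf_def sum.distrib distrib_left sum_distrib_left mult_ac)
  also have "\<dots> = K + 2 * S"
    using trf_sinh_odd[where A = A, OF A odd, of "\<lambda>x. sinh (2 * x)"] by simp
  also have "\<dots> \<le> K * (1 + 2 * b / (1 - b))"
  proof -
    have "K * (1 + 2 * b / (1 - b)) = K + 2 * (K * b / (1 - b))" by (simp add: distrib_left)
    then show ?thesis using \<open>S \<le> K * b / (1 - b)\<close> by linarith
  qed
  finally show ?thesis by (simp add: K_def)
qed

end

subsection \<open>Matched pairs of sets\<close>

definition slice :: "nat \<Rightarrow> nat \<Rightarrow> nat set set" where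
  "slice n k = {X. X \<subseteq> {..<n} \<and> card X = k}"

lemma finite_slice: "finite (slice n k)"
  by (rule finite_subset[of _ "Pow {..<n}"]) (auto simp: slice_def)

text \<open>
  A pair of lists without repetitions encodes two \<open>k\<close>-sets together with a bijection between
  them that fixes their intersection: the last condition forces a common element to occur at the
  same position in both lists.
\<close>

definition matchings :: "nat \<Rightarrow> nat \<Rightarrow> (nat list \<times> nat list) set" where
  "matchings n k = {(xs, ys). length xs = k \<and> length ys = k \<and> distinct xs \<and> distinct ys \<and>
     set xs \<subseteq> {..<n} \<and> set ys \<subseteq> {..<n} \<and> (\<forall>s<k. \<forall>r<k. xs ! s = ys ! r \<longrightarrow> s = r)}"

definition swap_at :: "nat \<Rightarrow> nat list \<times> nat list \<Rightarrow> nat list \<times> nat list" where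
  "swap_at s = (\<lambda>(xs, ys). (xs[s := ys ! s], ys[s := xs ! s]))"

definition vertex_sets :: "nat list \<times> nat list \<Rightarrow> nat set \<times> nat set" where
  "vertex_sets = map_prod set set"

lemma finite_matchings: "finite (matchings n k)"
proof (rule finite_subset)
  let ?L = "{xs. set xs \<subseteq> {..<n} \<and> length xs = k}"
  show "matchings n k \<subseteq> ?L \<times> ?L" by (auto simp: matchings_def)
  show "finite (?L \<times> ?L)" by (intro finite_cartesian_product finite_lists_length_eq) auto
qed

lemma sets_matchings: "\<omega> \<in> matchings n k \<Longrightarrow> vertex_sets \<omega> \<in> slice n k \<times> slice n k"
  by (auto simp: matchings_def vertex_sets_def slice_def distinct_card)

lemma map_matchings:
  assumes \<omega>: "\<omega> \<in> matchings n k" and t: "inj t" "t ` {..<n} \<subseteq> {..<n}"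
  shows "map_prod (map t) (map t) \<omega> \<in> matchings n k"
  using assms
  by (auto simp: matchings_def distinct_map inj_on_subset[OF t(1)] inj_eq image_subset_iff subset_iff)

text \<open>The two exchanged elements occur at no other position of either list, so swapping one
  position is the same as relabelling the ground set by a transposition.\<close>

lemma swap_at_eq_map_transpose:
  assumes "(xs, ys) \<in> matchings n k" "s < k"
  shows "swap_at s (xs, ys) =
    map_prod (map (Transposition.transpose (xs ! s) (ys ! s))) (map (Transposition.transpose (xs ! s) (ys ! s))) (xs, ys)"
proof -
  have *: "length xs = k" "length ys = k" "distinct xs" "distinct ys"
    "\<And>s r. s < k \<Longrightarrow> r < k \<Longrightarrow> xs ! s = ys ! r \<Longrightarrow> s = r"
    using assms(1) by (auto simp: matchings_def)
  have "xs[s := ys ! s] = map (Transposition.transpose (xs ! s) (ys ! s)) xs"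
  proof (rule nth_equalityI)
    fix r assume "r < length (xs[s := ys ! s])"
    then have r: "r < k" using * by simp
    show "xs[s := ys ! s] ! r = map (Transposition.transpose (xs ! s) (ys ! s)) xs ! r"
      using r * assms(2) *(5)[of r s] by (cases "r = s") (auto simp: Transposition.transpose_def nth_eq_iff_index_eq)
  qed (simp add: *)
  moreover have "ys[s := xs ! s] = map (Transposition.transpose (xs ! s) (ys ! s)) ys"
  proof (rule nth_equalityI)
    fix r assume "r < length (ys[s := xs ! s])"
    then have r: "r < k" using * by simp
    show "ys[s := xs ! s] ! r = map (Transposition.transpose (xs ! s) (ys ! s)) ys ! r"
    proof (cases "r = s")
      case False
      then have "ys ! r \<noteq> xs ! s" using *(5)[OF assms(2) r] by metis
      then show ?thesis
        using False r * assms(2) by (simp add: Transposition.transpose_def nth_eq_iff_index_eq)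
    qed (use r * in \<open>simp add: Transposition.transpose_def\<close>)
  qed (simp add: *)
  ultimately show ?thesis by (simp add: swap_at_def)
qed

lemma transpose_preserves_below:
  fixes i j :: nat
  assumes "i < n" "j < n"
  shows "Transposition.transpose i j ` {..<n} \<subseteq> {..<n}"
  using assms by (auto simp: Transposition.transpose_def)

lemma matchings_nth_less:
  assumes "(xs, ys) \<in> matchings n k" "s < k"
  shows "xs ! s < n" "ys ! s < n"
  using assms by (auto simp: matchings_def subset_iff)

lemma swap_at_matchings:
  assumes \<omega>: "\<omega> \<in> matchings n k" and s: "s < k"
  shows "swap_at s \<omega> \<in> matchings n k"
proof -
  obtain xs ys where xy: "\<omega> = (xs, ys)" by force
  note m = matchings_nth_less[OF \<omega>[unfolded xy] s]
  show ?thesis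
    unfolding xy swap_at_eq_map_transpose[OF \<omega>[unfolded xy] s]
    by (rule map_matchings[OF \<omega>[unfolded xy] inj_transpose transpose_preserves_below[OF m]])
qed

lemma swap_at_swap_at: "\<omega> \<in> matchings n k \<Longrightarrow> s < k \<Longrightarrow> swap_at s (swap_at s \<omega>) = \<omega>"
  by (auto simp: matchings_def swap_at_def)

lemma swap_at_commute: 
  "\<omega> \<in> matchings n k \<Longrightarrow> s < k \<Longrightarrow> r < k \<Longrightarrow> swap_at s (swap_at r \<omega>) = swap_at r (swap_at s \<omega>)"
  by (cases "s = r") (auto simp: matchings_def swap_at_def list_update_swap)

lemma swap_matchings: "\<omega> \<in> matchings n k \<Longrightarrow> prod.swap \<omega> \<in> matchings n k"
  by (force simp: matchings_def)

text \<open>Swapping the first \<open>m\<close> positions exchanges the prefixes of length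
  \<open>m\<close>; for \<open>m = k\<close> the two lists are interchanged completely.\<close>

lemma fold_swap_at:
  assumes "length xs = k" "length ys = k" "m \<le> k"
  shows "fold swap_at [0..<m] (xs, ys) = (take m ys @ drop m xs, take m xs @ drop m ys)"
  using assms(3)
proof (induction m)
  case (Suc m)
  have "swap_at m (take m ys @ drop m xs, take m xs @ drop m ys)
      = (take (Suc m) ys @ drop (Suc m) xs, take (Suc m) xs @ drop (Suc m) ys)"
    using Suc.prems assms(1,2)
    by (auto simp: swap_at_def list_update_append take_Suc_conv_app_nth nth_append
        Cons_nth_drop_Suc[symmetric])
  then show ?case using Suc by simp
qed simp

lemma fold_swap_at_swap:
  assumes "\<omega> \<in> matchings n k"
  shows "prod.swap \<omega> = fold swap_at [0..<k] \<omega>"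
  using assms by (cases \<omega>) (auto simp: matchings_def fold_swap_at)

section \<open>Fibres over a pair of sets and the weight on matchings\<close>

definition fibre_card :: "nat \<Rightarrow> nat \<Rightarrow> nat set \<times> nat set \<Rightarrow> nat" where
  "fibre_card n k Z = card {\<omega> \<in> matchings n k. vertex_sets \<omega> = Z}"

text \<open>An involutive relabelling of the ground set maps the two fibres onto each other and is
  its own inverse.\<close>

lemma fibre_card_image:
  assumes t: "inj t" "t ` {..<n} \<subseteq> {..<n}" and tt: "\<And>i. t (t i) = i"
  shows "fibre_card n k (map_prod ((`) t) ((`) t) Z) = fibre_card n k Z"
proof -
  let ?t = "map_prod (map t) (map t)" and ?T = "map_prod ((`) t) ((`) t)"
  have vertex_sets: "vertex_sets (?t \<omega>) = ?T (vertex_sets \<omega>)" for \<omega>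
    by (cases \<omega>) (simp add: vertex_sets_def)
  have TT: "?T (?T Z) = Z" for Z
    by (cases Z) (simp add: image_image tt)
  have tt': "?t (?t \<omega>) = \<omega>" for \<omega>
    by (cases \<omega>) (simp add: o_def tt)
  show ?thesis
    unfolding fibre_card_def
    by (rule bij_betw_same_card[of ?t], rule bij_betw_byWitness[where f' = ?t])
       (simp_all add: image_subset_iff vertex_sets TT tt' map_matchings[OF _ t] del: map_prod_simp split_paired_All)
qed

text \<open>A matching is built by listing the intersection first in both lists and the two set
  differences after it. Positivity justifies dividing by the fibre cardinality.\<close>

lemma fibre_card_pos:
  assumes "Z \<in> slice n k \<times> slice n k"
  shows "fibre_card n k Z > 0"
proof -
  obtain X Y where Z: "Z = (X, Y)" and X: "X \<subseteq> {..<n}" "card X = k" and Y: "Y \<subseteq> {..<n}" "card Y = k"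
    using assms by (auto simp: slice_def)
  have fin: "finite X" "finite Y" using X Y finite_subset by auto
  obtain as where as: "set as = X \<inter> Y" "distinct as"
    using fin finite_distinct_list[of "X \<inter> Y"] by auto
  obtain bs where bs: "set bs = X - Y" "distinct bs"
    using fin finite_distinct_list[of "X - Y"] by auto
  obtain cs where cs: "set cs = Y - X" "distinct cs"
    using fin finite_distinct_list[of "Y - X"] by auto
  have sX: "set (as @ bs) = X" and sY: "set (as @ cs) = Y"
    using as bs cs by auto
  have d: "distinct (as @ bs)" "distinct (as @ cs)" using as bs cs by auto
  have len: "length (as @ bs) = k" "length (as @ cs) = k"
    using distinct_card[OF d(1)] distinct_card[OF d(2)] sX sY X Y by auto
  \<comment> \<open>A common entry belongs to both sets, so it lies in the shared prefix
    \<open>as\<close>, where both lists agree and have no repetitions.\<close>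
  have "s = r" if "s < k" "r < k" "(as @ bs) ! s = (as @ cs) ! r" for s r
  proof -
    have "(as @ bs) ! s \<in> (if s < length as then X \<inter> Y else X - Y)"
      using that(1) len(1) as(1) bs(1) nth_mem[of s as] nth_mem[of "s - length as" bs]
      by (auto simp: nth_append)
    moreover have "(as @ cs) ! r \<in> (if r < length as then X \<inter> Y else Y - X)"
      using that(2) len(2) as(1) cs(1) nth_mem[of r as] nth_mem[of "r - length as" cs]
      by (auto simp: nth_append)
    ultimately have "s < length as \<and> r < length as"
      using that(3) by (auto split: if_splits)
    then show ?thesis
      using that(3) as(2) by (simp add: nth_append nth_eq_iff_index_eq)
  qed
  then have "(as @ bs, as @ cs) \<in> {\<omega> \<in> matchings n k. vertex_sets \<omega> = Z}"
    using d len X Y sX sY unfolding matchings_def vertex_sets_def Z by auto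
  then show ?thesis
    unfolding fibre_card_def using finite_matchings by (auto simp: card_gt_0_iff)
qed

text \<open>
  A pair of independent sets followed by a uniformly random bijection. The fibre cardinality is
  not computed: the weight only has to be invariant under \<open>swap_at\<close>, which acts on a
  matching as a transposition of the ground set.
\<close>

definition matching_weight :: "nat \<Rightarrow> nat \<Rightarrow> (nat set \<Rightarrow> real) \<Rightarrow> nat list \<times> nat list \<Rightarrow> real" where
  "matching_weight n k P \<omega> =
     P (fst (vertex_sets \<omega>)) * P (snd (vertex_sets \<omega>)) / real (fibre_card n k (vertex_sets \<omega>))"

text \<open>Within each fibre the weights add up to \<open>P X * P Y\<close>: passing to the vertex
  sets recovers two independent sets.\<close>

lemma sum_matching_weight:
  "(\<Sum>\<omega>\<in>matchings n k. matching_weight n k P \<omega> * F (vertex_sets \<omega>))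
    = (\<Sum>X\<in>slice n k. \<Sum>Y\<in>slice n k. P X * P Y * F (X, Y))"
proof -
  let ?S = "slice n k \<times> slice n k"
  have "(\<Sum>\<omega>\<in>matchings n k. matching_weight n k P \<omega> * F (vertex_sets \<omega>))
      = (\<Sum>Z\<in>?S. \<Sum>\<omega>\<in>{\<omega> \<in> matchings n k. vertex_sets \<omega> = Z}. matching_weight n k P \<omega> * F (vertex_sets \<omega>))"
    by (rule sum.group[symmetric])
       (simp_all add: finite_matchings finite_slice image_subset_iff sets_matchings del: mem_Times_iff)
  also have "\<dots> = (\<Sum>Z\<in>?S. P (fst Z) * P (snd Z) * F Z)"
  proof (rule sum.cong)
    fix Z assume "Z \<in> ?S"
    then have "real (fibre_card n k Z) \<noteq> 0" using fibre_card_pos by fastforce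
    then show "(\<Sum>\<omega>\<in>{\<omega> \<in> matchings n k. vertex_sets \<omega> = Z}. matching_weight n k P \<omega> * F (vertex_sets \<omega>))
        = P (fst Z) * P (snd Z) * F Z"
      by (simp add: matching_weight_def flip: fibre_card_def)
  qed simp
  finally show ?thesis by (simp add: sum.cartesian_product case_prod_unfold)
qed

text \<open>A statement about the product \<open>P X * P Y\<close> under an exchange between both
  sets, not invariance of \<open>P\<close> under permutations.\<close>

definition exchangeable :: "nat \<Rightarrow> nat \<Rightarrow> (nat set \<Rightarrow> real) \<Rightarrow> bool" where
  "exchangeable n k P \<longleftrightarrow> (\<forall>X\<in>slice n k. \<forall>Y\<in>slice n k. \<forall>i\<in>X - Y. \<forall>j\<in>Y - X.
     P (insert j (X - {i})) * P (insert i (Y - {j})) = P X * P Y)"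

lemma transpose_image_exchange:
  assumes "i \<in> X" "j \<notin> X"
  shows "Transposition.transpose i j ` X = insert j (X - {i})"
  using assms by (auto simp: Transposition.transpose_def image_iff split: if_splits)

text \<open>A common element sits at the same position in both lists, so an entry differing from its
  partner lies outside the other set, and the transposition is a genuine exchange.\<close>

lemma sets_swap_at:
  assumes \<omega>: "(xs, ys) \<in> matchings n k" and s: "s < k" and ne: "xs ! s \<noteq> ys ! s"
  shows "xs ! s \<in> set xs - set ys" "ys ! s \<in> set ys - set xs"
    "vertex_sets (swap_at s (xs, ys)) = (insert (ys ! s) (set xs - {xs ! s}), insert (xs ! s) (set ys - {ys ! s}))"
proof -
  have *: "length xs = k" "length ys = k"
    "\<And>s r. s < k \<Longrightarrow> r < k \<Longrightarrow> xs ! s = ys ! r \<Longrightarrow> s = r"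
    using \<omega> by (auto simp: matchings_def)
  show 1: "xs ! s \<in> set xs - set ys"
    using * s ne by (auto simp: in_set_conv_nth) metis
  show 2: "ys ! s \<in> set ys - set xs"
    using * s ne by (auto simp: in_set_conv_nth)
  show "vertex_sets (swap_at s (xs, ys)) = (insert (ys ! s) (set xs - {xs ! s}), insert (xs ! s) (set ys - {ys ! s}))"
    using transpose_image_exchange[of "xs ! s" "set xs" "ys ! s"]
      transpose_image_exchange[of "ys ! s" "set ys" "xs ! s"] 1 2
    unfolding swap_at_eq_map_transpose[OF \<omega> s]
    by (simp add: vertex_sets_def Transposition.transpose_commute[of "ys ! s"])
qed

lemma swap_at_trivial:
  assumes "xs ! s = ys ! s"
  shows "swap_at s (xs, ys) = (xs, ys)"
  using assms by (simp add: swap_at_def) (metis list_update_id)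

text \<open>Exchangeability preserves the numerator. The denominator is preserved because the swap
  relabels the ground set.\<close>

lemma matching_weight_swap_at:
  assumes P: "exchangeable n k P" and \<omega>: "\<omega> \<in> matchings n k" and s: "s < k"
  shows "matching_weight n k P (swap_at s \<omega>) = matching_weight n k P \<omega>"
proof -
  obtain xs ys where xy: "\<omega> = (xs, ys)" by force
  note \<omega>' = \<omega>[unfolded xy]
  let ?t = "Transposition.transpose (xs ! s) (ys ! s)"
  show ?thesis
  proof (cases "xs ! s = ys ! s")
    case True
    then show ?thesis by (simp add: xy swap_at_trivial)
  next
    case False
    have "vertex_sets (swap_at s \<omega>) = map_prod ((`) ?t) ((`) ?t) (vertex_sets \<omega>)"
      unfolding xy swap_at_eq_map_transpose[OF \<omega>' s] by (simp add: vertex_sets_def)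
    then have "fibre_card n k (vertex_sets (swap_at s \<omega>)) = fibre_card n k (vertex_sets \<omega>)"
      using fibre_card_image[OF inj_transpose transpose_preserves_below[OF matchings_nth_less[OF \<omega>' s]]]
      by simp
    moreover have "P (fst (vertex_sets (swap_at s \<omega>))) * P (snd (vertex_sets (swap_at s \<omega>)))
        = P (fst (vertex_sets \<omega>)) * P (snd (vertex_sets \<omega>))"
      using P sets_swap_at[OF \<omega>' s False] sets_matchings[OF \<omega>']
      unfolding exchangeable_def xy by (simp add: vertex_sets_def)
    ultimately show ?thesis by (simp add: matching_weight_def)
  qed
qed

lemma sets_swap: "vertex_sets (prod.swap \<omega>) = prod.swap (vertex_sets \<omega>)"
  by (cases \<omega>) (simp add: vertex_sets_def)

lemma fibre_card_swap: "fibre_card n k (prod.swap Z) = fibre_card n k Z"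
  unfolding fibre_card_def
  by (rule bij_betw_same_card[of prod.swap], rule bij_betw_byWitness[where f' = prod.swap])
     (simp_all add: image_subset_iff sets_swap swap_matchings del: split_paired_All)

lemma matching_weight_swap: "matching_weight n k P (prod.swap \<omega>) = matching_weight n k P \<omega>"
  by (simp add: matching_weight_def sets_swap fibre_card_swap mult.commute)

lemma commuting_involutions_matchings:
  assumes P: "exchangeable n k P" "\<And>X. 0 \<le> P X"
  shows "commuting_involutions (matchings n k) (matching_weight n k P) k swap_at prod.swap"
proof
  show "finite (matchings n k)" by (rule finite_matchings)
  fix s r \<omega> assume \<omega>: "\<omega> \<in> matchings n k"
  show "0 \<le> matching_weight n k P \<omega>" by (simp add: matching_weight_def P(2))
  show "prod.swap \<omega> \<in> matchings n k" by (rule swap_matchings[OF \<omega>])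
  show "matching_weight n k P (prod.swap \<omega>) = matching_weight n k P \<omega>" by (rule matching_weight_swap)
  show "\<exists>ss. set ss \<subseteq> {..<k} \<and> prod.swap \<omega> = fold swap_at ss \<omega>"
    using fold_swap_at_swap[OF \<omega>] by (intro exI[of _ "[0..<k]"]) auto
  assume s: "s < k"
  show "swap_at s \<omega> \<in> matchings n k" by (rule swap_at_matchings[OF \<omega> s])
  show "swap_at s (swap_at s \<omega>) = \<omega>" by (rule swap_at_swap_at[OF \<omega> s])
  show "matching_weight n k P (swap_at s \<omega>) = matching_weight n k P \<omega>"
    by (rule matching_weight_swap_at[OF P(1) \<omega> s])
  show "prod.swap (swap_at s \<omega>) = swap_at s (prod.swap \<omega>)"
    by (cases \<omega>) (simp add: swap_at_def)
  show "r < k \<Longrightarrow> swap_at s (swap_at r \<omega>) = swap_at r (swap_at s \<omega>)"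
    by (rule swap_at_commute[OF \<omega> s])
qed simp

subsection \<open>Concentration on a slice\<close>

lemma sum_nth_eq_sum_set:
  fixes g :: "'b \<Rightarrow> real"
  assumes "distinct xs"
  shows "(\<Sum>s<length xs. g (xs ! s)) = sum g (set xs)"
  using sum.distinct_set_conv_list[OF assms, of g] sum_list_sum_nth[of "map g xs"]
  by (simp add: atLeast0LessThan)

text \<open>Applies \<open>trf_exp_le\<close> to \<open>c *\<^sub>R (F X v - F Y v)\<close> on
  matchings. Summing over positions runs through both sets once, which bounds the increments by
  \<open>16 * c\<^sup>2 * S\<close>, that is 4 times \<open>4 * c\<^sup>2 * S\<close>.\<close>

lemma slice_trf_exp_le:
  fixes F :: "nat set \<Rightarrow> 'a::euclidean_space \<Rightarrow> 'a" and q :: "nat \<Rightarrow> 'a \<Rightarrow> real"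
  assumes P: "exchangeable n k P" "\<And>X. 0 \<le> P X" "(\<Sum>X\<in>slice n k. P X) = 1"
    and F: "\<And>X. X \<in> slice n k \<Longrightarrow> selfadjoint (F X)"
    and diff: "\<And>X i j v. X \<in> slice n k \<Longrightarrow> i \<in> X \<Longrightarrow> j < n \<Longrightarrow> j \<notin> X \<Longrightarrow>
      (norm (F X v - F (insert j (X - {i})) v))\<^sup>2 \<le> 2 * (q i v + q j v)"
    and q: "\<And>i v. i < n \<Longrightarrow> 0 \<le> q i v"
    and S: "\<And>X v. X \<in> slice n k \<Longrightarrow> norm v = 1 \<Longrightarrow> (\<Sum>i\<in>X. q i v) \<le> S"
    and b: "4 * c\<^sup>2 * S < 1"
  shows "(\<Sum>X\<in>slice n k. \<Sum>Y\<in>slice n k. P X * P Y * trf (\<lambda>x. exp (2 * x)) (\<lambda>v. c *\<^sub>R (F X v - F Y v)))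
    \<le> real DIM('a) * (1 + 2 * (4 * c\<^sup>2 * S) / (1 - 4 * c\<^sup>2 * S))"
proof -
  interpret commuting_involutions "matchings n k" "matching_weight n k P" k swap_at prod.swap
    using P by (intro commuting_involutions_matchings)
  define D where "D Z v = F (fst Z) v - F (snd Z) v" for Z v
  define A where "A \<omega> v = c *\<^sub>R D (vertex_sets \<omega>) v" for \<omega> v
  have sa: "selfadjoint (A \<omega>)" if "\<omega> \<in> matchings n k" for \<omega>
    unfolding A_def D_def using sets_matchings[OF that]
    by (intro selfadjoint_scaleR selfadjoint_diff F) auto
  have odd: "A (prod.swap \<omega>) = (\<lambda>v. - A \<omega> v)" for \<omega>
    by (simp add: A_def D_def sets_swap fun_eq_iff flip: scaleR_minus_right)
  have bound: "(\<Sum>s<k. (norm (A \<omega> v - A (swap_at s \<omega>) v))\<^sup>2) \<le> 4 * (4 * c\<^sup>2 * S)"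
    if \<omega>: "\<omega> \<in> matchings n k" and v: "norm v = 1" for \<omega> v
  proof -
    obtain xs ys where xy: "\<omega> = (xs, ys)" by force
    note \<omega>' = \<omega>[unfolded xy]
    have len: "length xs = k" "length ys = k" "distinct xs" "distinct ys"
      using \<omega>' by (auto simp: matchings_def)
    have sl: "set xs \<in> slice n k" "set ys \<in> slice n k"
      using sets_matchings[OF \<omega>'] by (auto simp: vertex_sets_def)
    have "(norm (A \<omega> v - A (swap_at s \<omega>) v))\<^sup>2 \<le> 8 * c\<^sup>2 * (q (xs ! s) v + q (ys ! s) v)"
      if s: "s < k" for s
    proof (cases "xs ! s = ys ! s")
      case True
      then show ?thesis
        using q matchings_nth_less[OF \<omega>' s] by (simp add: xy swap_at_trivial)
    next
      case False
      note sw = sets_swap_at[OF \<omega>' s False]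
      let ?X = "insert (ys ! s) (set xs - {xs ! s})" and ?Y = "insert (xs ! s) (set ys - {ys ! s})"
      have "A \<omega> v - A (swap_at s \<omega>) v
          = c *\<^sub>R ((F (set xs) v - F ?X v) + (F ?Y v - F (set ys) v))"
        by (simp add: xy A_def D_def sw(3)) (simp add: vertex_sets_def algebra_simps)
      then have "(norm (A \<omega> v - A (swap_at s \<omega>) v))\<^sup>2
          = c\<^sup>2 * (norm ((F (set xs) v - F ?X v) + (F ?Y v - F (set ys) v)))\<^sup>2"
        by (simp add: power_mult_distrib)
      \<comment> \<open>Both sets change at once. Splitting costs a factor 2 and each set
        contributes twice \<open>q (xs ! s) v + q (ys ! s) v\<close>, which gives the constant
        8.\<close>
      also have "\<dots> \<le> c\<^sup>2 * (2 * ((norm (F (set xs) v - F ?X v))\<^sup>2 + (norm (F ?Y v - F (set ys) v))\<^sup>2))"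
        by (intro mult_left_mono norm_add_power2_le) auto
      also have "\<dots> \<le> c\<^sup>2 * (2 * (2 * (q (xs ! s) v + q (ys ! s) v) + 2 * (q (ys ! s) v + q (xs ! s) v)))"
        using diff[OF sl(1), of "xs ! s" "ys ! s" v] diff[OF sl(2), of "ys ! s" "xs ! s" v]
          sw(1,2) matchings_nth_less[OF \<omega>' s]
        by (intro mult_left_mono add_mono) (auto simp: norm_minus_commute)
      finally show ?thesis by (simp add: algebra_simps)
    qed
    then have "(\<Sum>s<k. (norm (A \<omega> v - A (swap_at s \<omega>) v))\<^sup>2)
        \<le> (\<Sum>s<k. 8 * c\<^sup>2 * (q (xs ! s) v + q (ys ! s) v))"
      by (intro sum_mono) auto
    also have "\<dots> = 8 * c\<^sup>2 * ((\<Sum>i\<in>set xs. q i v) + (\<Sum>i\<in>set ys. q i v))"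
      using sum_nth_eq_sum_set[of xs "\<lambda>i. q i v"] sum_nth_eq_sum_set[of ys "\<lambda>i. q i v"] len
      by (simp add: sum.distrib flip: sum_distrib_left)
    also have "\<dots> \<le> 8 * c\<^sup>2 * (S + S)"
      using S[OF sl(1) v] S[OF sl(2) v] by (intro mult_left_mono add_mono) auto
    finally show ?thesis by simp
  qed
  have total: "(\<Sum>\<omega>\<in>matchings n k. matching_weight n k P \<omega>) = 1"
    using sum_matching_weight[of n k P "\<lambda>_. 1"] P(3)
    by (simp flip: sum_distrib_left)
  have "(\<Sum>\<omega>\<in>matchings n k. matching_weight n k P \<omega> * trf (\<lambda>x. exp (2 * x)) (A \<omega>))
      \<le> real DIM('a) * (1 + 2 * (4 * c\<^sup>2 * S) / (1 - 4 * c\<^sup>2 * S))"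
    using trf_exp_le[where A = A, OF sa odd bound b] total by simp
  moreover have "(\<Sum>\<omega>\<in>matchings n k. matching_weight n k P \<omega> * trf (\<lambda>x. exp (2 * x)) (A \<omega>))
      = (\<Sum>X\<in>slice n k. \<Sum>Y\<in>slice n k. P X * P Y * trf (\<lambda>x. exp (2 * x)) (\<lambda>v. c *\<^sub>R (F X v - F Y v)))"
    using sum_matching_weight[of n k P "\<lambda>Z. trf (\<lambda>x. exp (2 * x)) (\<lambda>v. c *\<^sub>R D Z v)"]
    by (simp add: A_def[abs_def] D_def)
  ultimately show ?thesis by simp
qed

text \<open>Bessel's inequality: each eigenvector gives total weight at most 1 to the orthonormal
  pair, and \<open>\<phi>\<close> is nonnegative.\<close>

lemma inner_fcalc_pair_le_trf:
  assumes A: "selfadjoint A" and \<phi>: "\<And>x. 0 \<le> \<phi> x"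
    and u: "norm u = 1" "norm v = 1" "u \<bullet> v = 0"
  shows "u \<bullet> fcalc \<phi> A u + v \<bullet> fcalc \<phi> A v \<le> trf \<phi> A"
proof -
  have bessel: "(b \<bullet> u)\<^sup>2 + (b \<bullet> v)\<^sup>2 \<le> 1" if "norm b = 1" for b
  proof -
    have "0 \<le> (norm (b - (b \<bullet> u) *\<^sub>R u - (b \<bullet> v) *\<^sub>R v))\<^sup>2" by simp
    also have "\<dots> = 1 - (b \<bullet> u)\<^sup>2 - (b \<bullet> v)\<^sup>2"
      using u that unfolding power2_norm_eq_inner norm_eq_1
      by (simp add: inner_diff_left inner_diff_right inner_commute power2_eq_square)
    finally show ?thesis by simp
  qed
  have "u \<bullet> fcalc \<phi> A u + v \<bullet> fcalc \<phi> A v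
      = (\<Sum>b\<in>eigenbasis A. \<phi> (b \<bullet> A b) * ((b \<bullet> u)\<^sup>2 + (b \<bullet> v)\<^sup>2))"
    by (simp add: fcalc_def inner_sum_right sum.distrib[symmetric] power2_eq_square
        inner_commute distrib_left mult_ac)
  also have "\<dots> \<le> (\<Sum>b\<in>eigenbasis A. \<phi> (b \<bullet> A b) * 1)"
    using orthonormal_eigenbasis[OF A]
    by (intro sum_mono mult_left_mono bessel \<phi>) (auto simp: orthonormal_basis_def)
  finally show ?thesis by (simp add: trf_def)
qed

text \<open>Jensen's inequality twice: first over \<open>I\<close> with weights \<open>P\<close>,
  replacing the mean by an independent copy, then over the spectrum of each difference.\<close>

lemma exp_le_sum_inner_fcalc:
  fixes F :: "'i \<Rightarrow> 'a::euclidean_space \<Rightarrow> 'a"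
  assumes I: "finite I" "\<And>i. i \<in> I \<Longrightarrow> 0 \<le> P i" "sum P I = 1"
    and F: "\<And>i. i \<in> I \<Longrightarrow> selfadjoint (F i)" and G: "selfadjoint G"
    and u: "norm u = 1" "t \<le> u \<bullet> (G u - (\<Sum>i\<in>I. P i *\<^sub>R F i u))" and c: "0 \<le> c"
  shows "exp (2 * (c * t)) \<le>
    (\<Sum>i\<in>I. P i * (u \<bullet> fcalc (\<lambda>x. exp (2 * x)) (\<lambda>v. c *\<^sub>R (G v - F i v)) u))"
proof -
  let ?\<phi> = "\<lambda>x::real. exp (2 * x)" and ?A = "\<lambda>i v. c *\<^sub>R (G v - F i v)"
  have conv: "convex_on UNIV ?\<phi>"
    by (rule f''_ge0_imp_convex[where f' = "\<lambda>x. 2 * exp (2 * x)" and f'' = "\<lambda>x. 4 * exp (2 * x)"])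
       (auto intro!: derivative_eq_intros)
  have ne: "I \<noteq> {}" using I(3) by auto
  have "(\<Sum>i\<in>I. P i * (u \<bullet> ?A i u)) = c * (sum P I * (u \<bullet> G u) - u \<bullet> (\<Sum>i\<in>I. P i *\<^sub>R F i u))"
    by (simp add: inner_diff_right inner_sum_right right_diff_distrib sum_subtractf sum_distrib_left
        sum_distrib_right mult_ac)
  then have "c * (u \<bullet> (G u - (\<Sum>i\<in>I. P i *\<^sub>R F i u))) = (\<Sum>i\<in>I. P i * (u \<bullet> ?A i u))"
    by (simp add: I(3) inner_diff_right)
  moreover have "c * t \<le> c * (u \<bullet> (G u - (\<Sum>i\<in>I. P i *\<^sub>R F i u)))"
    using u(2) c by (rule mult_left_mono)
  ultimately have "exp (2 * (c * t)) \<le> ?\<phi> (\<Sum>i\<in>I. P i * (u \<bullet> ?A i u))"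
    by simp
  also have "\<dots> \<le> (\<Sum>i\<in>I. P i * ?\<phi> (u \<bullet> ?A i u))"
    using convex_on_sum[OF I(1) ne conv I(3) I(2), of "\<lambda>i. u \<bullet> ?A i u"] by simp
  also have "\<dots> \<le> (\<Sum>i\<in>I. P i * (u \<bullet> fcalc ?\<phi> (?A i) u))"
    by (intro sum_mono mult_left_mono I convex_on_inner_le_fcalc[OF _ conv u(1)] selfadjoint_scaleR
        selfadjoint_diff G F)
  finally show ?thesis .
qed

text \<open>
  On a complex space every eigenvalue has even real multiplicity, which compensates the
  doubled real dimension; hence the pair \<open>u\<close>, \<open>v\<close>.
\<close>

lemma slice_tail_le:
  fixes F :: "nat set \<Rightarrow> 'a::euclidean_space \<Rightarrow> 'a" and q :: "nat \<Rightarrow> 'a \<Rightarrow> real"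
  assumes P: "exchangeable n k P" "\<And>X. 0 \<le> P X" "(\<Sum>X\<in>slice n k. P X) = 1"
    and F: "\<And>X. X \<in> slice n k \<Longrightarrow> selfadjoint (F X)"
    and diff: "\<And>X i j v. X \<in> slice n k \<Longrightarrow> i \<in> X \<Longrightarrow> j < n \<Longrightarrow> j \<notin> X \<Longrightarrow>
      (norm (F X v - F (insert j (X - {i})) v))\<^sup>2 \<le> 2 * (q i v + q j v)"
    and q: "\<And>i v. i < n \<Longrightarrow> 0 \<le> q i v"
    and S: "\<And>X v. X \<in> slice n k \<Longrightarrow> norm v = 1 \<Longrightarrow> (\<Sum>i\<in>X. q i v) \<le> S"
    and b: "4 * c\<^sup>2 * S < 1" and c: "0 \<le> c"
    and B: "B \<subseteq> slice n k"
    and bad: "\<And>X. X \<in> B \<Longrightarrow> \<exists>u v. norm u = 1 \<and> norm v = 1 \<and> u \<bullet> v = 0 \<and>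
      t \<le> u \<bullet> (F X u - (\<Sum>Y\<in>slice n k. P Y *\<^sub>R F Y u)) \<and>
      t \<le> v \<bullet> (F X v - (\<Sum>Y\<in>slice n k. P Y *\<^sub>R F Y v))"
  shows "2 * exp (2 * (c * t)) * (\<Sum>X\<in>B. P X)
    \<le> real DIM('a) * (1 + 2 * (4 * c\<^sup>2 * S) / (1 - 4 * c\<^sup>2 * S))"
proof -
  let ?\<phi> = "\<lambda>x::real. exp (2 * x)" and ?A = "\<lambda>X Y v. c *\<^sub>R (F X v - F Y v)"
  have sa: "selfadjoint (?A X Y)" if "X \<in> slice n k" "Y \<in> slice n k" for X Y
    using that by (intro selfadjoint_scaleR selfadjoint_diff F)
  have each: "2 * exp (2 * (c * t)) \<le> (\<Sum>Y\<in>slice n k. P Y * trf ?\<phi> (?A X Y))" if X: "X \<in> B" for X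
  proof -
    obtain u v where uv: "norm u = 1" "norm v = 1" "u \<bullet> v = 0"
      "t \<le> u \<bullet> (F X u - (\<Sum>Y\<in>slice n k. P Y *\<^sub>R F Y u))"
      "t \<le> v \<bullet> (F X v - (\<Sum>Y\<in>slice n k. P Y *\<^sub>R F Y v))"
      using bad[OF X] by blast
    have Xs: "X \<in> slice n k" using X B by auto
    have "2 * exp (2 * (c * t)) = exp (2 * (c * t)) + exp (2 * (c * t))" by simp
    also have "\<dots> \<le> (\<Sum>Y\<in>slice n k. P Y * (u \<bullet> fcalc ?\<phi> (?A X Y) u))
        + (\<Sum>Y\<in>slice n k. P Y * (v \<bullet> fcalc ?\<phi> (?A X Y) v))"
      by (intro add_mono exp_le_sum_inner_fcalc finite_slice P F Xs uv c)
    also have "\<dots> = (\<Sum>Y\<in>slice n k. P Y * (u \<bullet> fcalc ?\<phi> (?A X Y) u + v \<bullet> fcalc ?\<phi> (?A X Y) v))"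
      by (simp add: sum.distrib distrib_left)
    also have "\<dots> \<le> (\<Sum>Y\<in>slice n k. P Y * trf ?\<phi> (?A X Y))"
      by (intro sum_mono mult_left_mono P inner_fcalc_pair_le_trf sa Xs uv) auto
    finally show ?thesis .
  qed
  have nonneg: "0 \<le> (\<Sum>Y\<in>slice n k. P Y * trf ?\<phi> (?A X Y))" for X
    by (intro sum_nonneg mult_nonneg_nonneg P) (simp add: trf_def sum_nonneg)
  have "2 * exp (2 * (c * t)) * (\<Sum>X\<in>B. P X) = (\<Sum>X\<in>B. P X * (2 * exp (2 * (c * t))))"
    by (simp add: sum_distrib_left sum_distrib_right mult_ac)
  also have "\<dots> \<le> (\<Sum>X\<in>B. P X * (\<Sum>Y\<in>slice n k. P Y * trf ?\<phi> (?A X Y)))"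
    by (intro sum_mono mult_left_mono each P)
  \<comment> \<open>Markov's inequality: the omitted terms are nonnegative, so the sum may be
    enlarged from \<open>B\<close> to the whole slice.\<close>
  also have "\<dots> \<le> (\<Sum>X\<in>slice n k. P X * (\<Sum>Y\<in>slice n k. P Y * trf ?\<phi> (?A X Y)))"
    using B nonneg P by (intro sum_mono2 finite_slice mult_nonneg_nonneg) auto
  also have "\<dots> = (\<Sum>X\<in>slice n k. \<Sum>Y\<in>slice n k. P X * P Y * trf ?\<phi> (?A X Y))"
    by (simp add: sum_distrib_left mult_ac)
  also have "\<dots> \<le> real DIM('a) * (1 + 2 * (4 * c\<^sup>2 * S) / (1 - 4 * c\<^sup>2 * S))"
    by (rule slice_trf_exp_le[OF P F diff q S b])
  finally show ?thesis .
qed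

text \<open>Here \<open>b\<close> is at most 1/4, so \<open>2 * b / (1 - b) \<le> 4 * b \<le>
  t\<^sup>2 / (\<sigma>\<^sup>2 + \<sigma> * t)\<close>. The prefactor thus costs at most half of
  the exponent, which is twice the desired one.\<close>

lemma bernstein_exponent:
  fixes \<sigma> t :: real
  assumes \<sigma>: "0 < \<sigma>" and t: "0 < t"
  defines "b \<equiv> t\<^sup>2 / (4 * (\<sigma> + t)\<^sup>2)"
  shows "b < 1" and "exp (- (2 * t / (\<sigma> * (\<sigma> + t)) * t)) * (1 + 2 * b / (1 - b)) \<le> exp (- (t\<^sup>2) / (\<sigma>\<^sup>2 + \<sigma> * t))"
proof -
  have le: "4 * b \<le> 1"
    using assms by (simp add: b_def divide_simps power_mono)
  then show "b < 1" by simp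
  have b0: "0 \<le> b" by (simp add: b_def)
  have "2 * b / (1 - b) \<le> 4 * b"
  proof -
    have "2 * b \<le> 4 * b * (1 - b)"
      using le b0 mult_left_mono[OF le b0] by (simp add: algebra_simps)
    then show ?thesis using le by (simp add: pos_divide_le_eq)
  qed
  also have "4 * b \<le> t\<^sup>2 / (\<sigma>\<^sup>2 + \<sigma> * t)"
  proof -
    have "4 * b = t\<^sup>2 / (\<sigma> + t)\<^sup>2" by (simp add: b_def)
    also have "\<dots> \<le> t\<^sup>2 / (\<sigma>\<^sup>2 + \<sigma> * t)"
    proof (rule divide_left_mono)
      show "\<sigma>\<^sup>2 + \<sigma> * t \<le> (\<sigma> + t)\<^sup>2"
        using \<sigma> t by (simp add: power2_eq_square algebra_simps)
      show "0 < (\<sigma> + t)\<^sup>2 * (\<sigma>\<^sup>2 + \<sigma> * t)"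
        using \<sigma> t by (intro mult_pos_pos add_pos_pos) auto
    qed simp
    finally show ?thesis .
  qed
  finally have "1 + 2 * b / (1 - b) \<le> exp (t\<^sup>2 / (\<sigma>\<^sup>2 + \<sigma> * t))"
    using exp_ge_add_one_self[of "t\<^sup>2 / (\<sigma>\<^sup>2 + \<sigma> * t)"] by linarith
  then have "exp (- (2 * t / (\<sigma> * (\<sigma> + t)) * t)) * (1 + 2 * b / (1 - b))
      \<le> exp (- (2 * t / (\<sigma> * (\<sigma> + t)) * t)) * exp (t\<^sup>2 / (\<sigma>\<^sup>2 + \<sigma> * t))"
    by (intro mult_left_mono) auto
  also have "\<dots> = exp (- (t\<^sup>2) / (\<sigma>\<^sup>2 + \<sigma> * t))"
  proof -
    have "2 * t / (\<sigma> * (\<sigma> + t)) * t = 2 * (t\<^sup>2 / (\<sigma>\<^sup>2 + \<sigma> * t))"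
      by (simp add: power2_eq_square algebra_simps)
    then show ?thesis by (simp add: exp_add[symmetric])
  qed
  finally show "exp (- (2 * t / (\<sigma> * (\<sigma> + t)) * t)) * (1 + 2 * b / (1 - b)) \<le> exp (- (t\<^sup>2) / (\<sigma>\<^sup>2 + \<sigma> * t))" .
qed

subsection \<open>Hermitian matrices and conditioned Bernoulli variables\<close>

text \<open>The bridge between \<open>psd\<close>, stated with the complex sesquilinear form, and
  the underlying real Euclidean space.\<close>

lemma inner_complex_vec: "v \<bullet> w = Re (\<Sum>i\<in>UNIV. cnj (v $ i) * w $ i)" for v w :: "complex ^ 'd"
  by (simp add: inner_vec_def inner_complex_def)

lemma hermitian_selfadjoint:
  fixes A :: "complex ^ 'd ^ 'd"
  assumes "hermitian A"
  shows "selfadjoint ((*v) A)"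
  unfolding selfadjoint_def
proof (intro allI)
  fix v w :: "complex ^ 'd"
  have A: "cnj (A $ i $ j) = A $ j $ i" for i j
    using assms unfolding hermitian_def by (metis complex_cnj_cnj)
  have "(\<Sum>i\<in>UNIV. cnj ((A *v v) $ i) * w $ i)
      = (\<Sum>i\<in>UNIV. \<Sum>j\<in>UNIV. cnj (v $ j) * (A $ j $ i * w $ i))"
    by (simp add: matrix_vector_mult_def sum_distrib_left A mult_ac)
  also have "\<dots> = (\<Sum>j\<in>UNIV. cnj (v $ j) * (A *v w) $ j)"
    by (subst sum.swap) (simp add: matrix_vector_mult_def sum_distrib_left)
  finally show "(A *v v) \<bullet> w = v \<bullet> (A *v w)"
    by (simp only: inner_complex_vec)
qed

lemma hermitian_diff: "hermitian A \<Longrightarrow> hermitian B \<Longrightarrow> hermitian (A - B)"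
  unfolding hermitian_def
proof (intro allI)
  fix i j
  assume "\<forall>i j. A $ i $ j = cnj (A $ j $ i)" "\<forall>i j. B $ i $ j = cnj (B $ j $ i)"
  from this[THEN spec, THEN spec, of i j]
  show "(A - B) $ i $ j = cnj ((A - B) $ j $ i)" by simp
qed

lemma loewner_le_inner:
  assumes "A \<preceq>\<^sub>L B"
  shows "v \<bullet> (A *v v) \<le> v \<bullet> (B *v v)"
proof -
  have "0 \<le> v \<bullet> ((B - A) *v v)"
    using assms unfolding loewner_le_def psd_def inner_complex_vec by blast
  then show ?thesis by (simp add: matrix_vector_mult_diff_rdistrib inner_diff_right)
qed

text \<open>Turns a Loewner bound between squares into a bound between norms at each single
  vector.\<close>

lemma hermitian_inner_square:
  assumes "hermitian A"
  shows "v \<bullet> ((A ** A) *v v) = (norm (A *v v))\<^sup>2"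
  using selfadjointD[OF hermitian_selfadjoint[OF assms], of v "A *v v"]
  by (simp add: power2_norm_eq_inner matrix_vector_mul_assoc)

lemma linear_matrix_vector_mult_left: "linear (\<lambda>A :: complex ^ 'd ^ 'd. A *v v)"
  by (rule linearI)
     (simp_all add: vec_eq_iff matrix_vector_mult_def scaleR_sum_right distrib_right sum.distrib)

lemma complex_of_real_scale: "complex_of_real r *s v = r *\<^sub>R v"
  by (simp add: vec_eq_iff scaleR_conv_of_real[symmetric])

text \<open>An eigenvector and its multiple by the imaginary unit are orthogonal for the real inner
  product and share the eigenvalue.\<close>

lemma lambda_max_greater_eigenvectors:
  fixes A :: "complex ^ 'd ^ 'd"
  assumes A: "hermitian A" and t: "t < lambda_max A"
  shows "\<exists>u v. norm u = 1 \<and> norm v = 1 \<and> u \<bullet> v = 0 \<and> t \<le> u \<bullet> (A *v u) \<and> t \<le> v \<bullet> (A *v v)"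
proof -
  let ?E = "{r. \<exists>v. v \<noteq> 0 \<and> A *v v = complex_of_real r *s v}"
  note sa = hermitian_selfadjoint[OF A]
  note onb = orthonormal_eigenbasis[OF sa]
  have "eigenbasis ((*v) A) \<noteq> {}"
    using orthonormal_basis_card[OF onb] by force
  then obtain b where b: "b \<in> eigenbasis ((*v) A)" by auto
  have "b \<noteq> 0" using onb b by (auto simp: orthonormal_basis_def)
  then have ne: "?E \<noteq> {}"
    using eigenbasis_eigenvector[OF sa b] by (auto simp: complex_of_real_scale)
  \<comment> \<open>Finiteness of the spectrum, so that \<open>Max\<close> is attained: an
    eigenvector has a nonzero coordinate in the chosen eigenbasis, and the basis vector there has
    the same eigenvalue.\<close>
  have "?E \<subseteq> (\<lambda>b. b \<bullet> (A *v b)) ` eigenbasis ((*v) A)"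
  proof
    fix r assume "r \<in> ?E"
    then obtain v where v: "v \<noteq> 0" "A *v v = r *\<^sub>R v" by (auto simp: complex_of_real_scale)
    have "\<exists>b\<in>eigenbasis ((*v) A). b \<bullet> v \<noteq> 0"
    proof (rule ccontr)
      assume "\<not> ?thesis"
      then have "(\<Sum>b\<in>eigenbasis ((*v) A). (b \<bullet> v) *\<^sub>R b) = 0" by simp
      then show False using orthonormal_basis_expansion[OF onb, of v] v(1) by simp
    qed
    then obtain b where b: "b \<in> eigenbasis ((*v) A)" "b \<bullet> v \<noteq> 0" by blast
    have "(b \<bullet> (A *v b)) * (b \<bullet> v) = (A *v b) \<bullet> v"
      using eigenbasis_eigenvector[OF sa b(1)] by (metis inner_scaleR_left)
    also have "\<dots> = r * (b \<bullet> v)" using selfadjointD[OF sa, of b v] v(2) by simp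
    finally show "r \<in> (\<lambda>b. b \<bullet> (A *v b)) ` eigenbasis ((*v) A)" using b by auto
  qed
  then have "finite ?E"
    using finite_surj orthonormal_basis_finite[OF onb] by blast
  then have "lambda_max A \<in> ?E"
    unfolding lambda_max_def using ne by (rule Max_in)
  then obtain w where w: "w \<noteq> 0" "A *v w = lambda_max A *\<^sub>R w"
    by (auto simp: complex_of_real_scale)
  define u where "u = w /\<^sub>R norm w"
  have u: "norm u = 1" "A *v u = lambda_max A *\<^sub>R u"
    using w by (simp_all add: u_def linear_scale[OF matrix_vector_mul_linear])
  define v where "v = \<i> *s u"
  have vi: "v $ i = \<i> * u $ i" for i by (simp add: v_def)
  have "norm v = norm u" by (simp add: norm_vec_def vi norm_mult)
  moreover have "u \<bullet> v = 0"
    by (simp add: inner_vec_def inner_complex_def vi)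
  moreover have "A *v v = lambda_max A *\<^sub>R v"
    using u(2) by (simp add: v_def vector_scalar_commute vec_eq_iff)
  ultimately show ?thesis
    using u t by (intro exI[of _ u] exI[of _ v]) (simp add: norm_eq_1)
qed

section \<open>The conditioned Bernoulli law as a weight on sets\<close>

definition char_fun :: "nat set \<Rightarrow> nat \<Rightarrow> bool" where
  "char_fun X = (\<lambda>i. i \<in> X)"

lemma inj_char_fun: "inj char_fun"
  by (auto simp: inj_def char_fun_def fun_eq_iff)

lemma char_fun_cube: "X \<subseteq> {..<n} \<Longrightarrow> char_fun X \<in> cube n"
  by (auto simp: char_fun_def cube_def)

lemma pmf_bern_prod_char_fun:
  "X \<subseteq> {..<n} \<Longrightarrow> pmf (bern_prod n p) (char_fun X) = (\<Prod>i<n. pmf (bernoulli_pmf (p i)) (i \<in> X))"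
  unfolding bern_prod_def by (subst pmf_Pi') (auto simp: char_fun_def)

context
  fixes n k :: nat and p :: "nat \<Rightarrow> real"
  assumes p: "\<forall>i<n. 0 < p i \<and> p i < 1" and k: "k \<le> n"
begin

text \<open>Conditioning is meaningful only on an event meeting the support; the indicator of the
  first \<open>k\<close> coordinates is a witness.\<close>

lemma cond_bern_nonempty:
  "set_pmf (bern_prod n p) \<inter> {x. card {i. i < n \<and> x i} = k} \<noteq> {}"
proof -
  have "pmf (bern_prod n p) (char_fun {..<k}) > 0"
  proof -
    have "0 < pmf (bernoulli_pmf (p i)) b" if "i < n" for i b
      using p that by (cases b) auto
    then show ?thesis
      using k by (subst pmf_bern_prod_char_fun) (auto intro!: prod_pos)
  qed
  moreover have "{i. i < n \<and> char_fun {..<k} i} = {..<k}"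
    using k by (auto simp: char_fun_def)
  ultimately have "char_fun {..<k} \<in> set_pmf (bern_prod n p) \<inter> {x. card {i. i < n \<and> x i} = k}"
    by (simp add: set_pmf_iff)
  then show ?thesis by blast
qed

lemma set_pmf_cond_bern: "set_pmf (cond_bern n p k) \<subseteq> char_fun ` slice n k"
proof
  fix x assume "x \<in> set_pmf (cond_bern n p k)"
  then have "x \<in> set_pmf (bern_prod n p)" and card: "card {i. i < n \<and> x i} = k"
    using cond_bern_nonempty by (auto simp: cond_bern_def set_cond_pmf)
  \<comment> \<open>Outside the first \<open>n\<close> coordinates \<open>Pi_pmf\<close> takes its
    default value \<open>False\<close>.\<close>
  then have "\<And>i. n \<le> i \<Longrightarrow> \<not> x i"
    unfolding bern_prod_def using set_Pi_pmf_subset[of "{..<n}" False] by fastforce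
  then have "x = char_fun {i. i < n \<and> x i}"
    by (auto simp: char_fun_def fun_eq_iff) (meson not_le)
  moreover have "{i. i < n \<and> x i} \<in> slice n k" using card by (auto simp: slice_def)
  ultimately show "x \<in> char_fun ` slice n k" by blast
qed

lemma pmf_cond_bern_char_fun:
  assumes "X \<in> slice n k"
  shows "pmf (cond_bern n p k) (char_fun X) =
    (\<Prod>i<n. pmf (bernoulli_pmf (p i)) (i \<in> X)) /
      measure_pmf.prob (bern_prod n p) {x. card {i. i < n \<and> x i} = k}"
proof -
  have "{i. i < n \<and> char_fun X i} = X"
    using assms by (auto simp: char_fun_def slice_def)
  then show ?thesis
    using assms unfolding cond_bern_def pmf_cond[OF cond_bern_nonempty]
    by (simp add: slice_def pmf_bern_prod_char_fun)
qed

text \<open>At each coordinate the two pairs of sets contribute the same two factors, up to order,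
  and all four sets lie in the slice and share the normalising constant.\<close>

lemma exchangeable_cond_bern: "exchangeable n k (\<lambda>X. pmf (cond_bern n p k) (char_fun X))"
  unfolding exchangeable_def
proof (intro ballI)
  fix X Y i j assume X: "X \<in> slice n k" and Y: "Y \<in> slice n k" and i: "i \<in> X - Y" and j: "j \<in> Y - X"
  let ?X = "insert j (X - {i})" and ?Y = "insert i (Y - {j})"
  let ?r = "\<lambda>l b. pmf (bernoulli_pmf (p l)) b"
  have fin: "finite X" "finite Y" using X Y finite_subset by (auto simp: slice_def)
  have "?X \<in> slice n k" "?Y \<in> slice n k"
    using X Y i j fin card.remove[of X i] card.remove[of Y j] by (auto simp: slice_def)
  moreover have "(\<Prod>l<n. ?r l (l \<in> ?X)) * (\<Prod>l<n. ?r l (l \<in> ?Y)) = (\<Prod>l<n. ?r l (l \<in> X)) * (\<Prod>l<n. ?r l (l \<in> Y))"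
    unfolding prod.distrib[symmetric]
  proof (rule prod.cong)
    fix l
    have "i \<noteq> j" using i j by auto
    consider "l = i" | "l = j" | "l \<noteq> i" "l \<noteq> j" by blast
    then show "?r l (l \<in> ?X) * ?r l (l \<in> ?Y) = ?r l (l \<in> X) * ?r l (l \<in> Y)"
      by cases (use i j \<open>i \<noteq> j\<close> in auto)
  qed simp
  ultimately show "pmf (cond_bern n p k) (char_fun ?X) * pmf (cond_bern n p k) (char_fun ?Y)
      = pmf (cond_bern n p k) (char_fun X) * pmf (cond_bern n p k) (char_fun Y)"
    using X Y by (simp add: pmf_cond_bern_char_fun)
qed

lemma sum_pmf_cond_bern: "(\<Sum>X\<in>slice n k. pmf (cond_bern n p k) (char_fun X)) = 1"
proof -
  have "(\<Sum>x\<in>char_fun ` slice n k. pmf (cond_bern n p k) x) = 1"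
    by (rule sum_pmf_eq_1) (simp_all add: finite_slice set_pmf_cond_bern)
  then show ?thesis by (simp add: sum.reindex inj_on_subset[OF inj_char_fun])
qed

lemma expectation_cond_bern:
  fixes f :: "(nat \<Rightarrow> bool) \<Rightarrow> 'b::{banach, second_countable_topology}"
  shows "measure_pmf.expectation (cond_bern n p k) f
    = (\<Sum>X\<in>slice n k. pmf (cond_bern n p k) (char_fun X) *\<^sub>R f (char_fun X))"
proof -
  have "measure_pmf.expectation (cond_bern n p k) f
      = (\<Sum>x\<in>char_fun ` slice n k. pmf (cond_bern n p k) x *\<^sub>R f x)"
    by (rule integral_measure_pmf) (use finite_slice set_pmf_cond_bern in auto)
  then show ?thesis by (simp add: sum.reindex inj_on_subset[OF inj_char_fun])
qed

lemma prob_cond_bern: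
  "measure_pmf.prob (cond_bern n p k) {x. Q x}
    = (\<Sum>X\<in>{X \<in> slice n k. Q (char_fun X)}. pmf (cond_bern n p k) (char_fun X))"
proof -
  let ?B = "{X \<in> slice n k. Q (char_fun X)}"
  have "measure_pmf.prob (cond_bern n p k) {x. Q x} = measure_pmf.prob (cond_bern n p k) (char_fun ` ?B)"
    by (rule measure_pmf.finite_measure_eq_AE)
       (use set_pmf_cond_bern in \<open>auto simp: AE_measure_pmf_iff\<close>)
  also have "\<dots> = (\<Sum>x\<in>char_fun ` ?B. pmf (cond_bern n p k) x)"
    by (rule measure_measure_pmf_finite) (simp add: finite_slice)
  finally show ?thesis by (simp add: sum.reindex inj_on_subset[OF inj_char_fun])
qed

end

section \<open>From coordinate flips and operator norms to the tail bound\<close>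

lemma flip_char_fun:
  assumes "i \<in> X" "j \<notin> X"
  shows "flip (flip (char_fun X) i) j = char_fun (insert j (X - {i}))"
  using assms by (auto simp: flip_def char_fun_def fun_eq_iff)

lemma flip_cube: "x \<in> cube n \<Longrightarrow> i < n \<Longrightarrow> flip x i \<in> cube n"
  by (auto simp: cube_def flip_def)

text \<open>Cauchy-Schwarz bounds the quadratic form by the operator norm, and the supremum is an
  upper bound because there are finitely many index sets.\<close>

lemma sum_inner_le_Sup_op_norm:
  fixes M :: "nat \<Rightarrow> complex ^ 'd ^ 'd"
  assumes X: "X \<in> slice n k" and v: "norm v = 1"
  shows "(\<Sum>i\<in>X. v \<bullet> (M i *v v)) \<le> Sup {op_norm (\<Sum>i\<in>I. M i) | I. I \<subseteq> {..<n} \<and> card I = k}"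
proof -
  have "(\<Sum>i\<in>X. v \<bullet> (M i *v v)) = v \<bullet> ((\<Sum>i\<in>X. M i) *v v)"
    by (simp add: linear_sum[OF linear_matrix_vector_mult_left] inner_sum_right)
  also have "\<dots> \<le> norm v * norm ((\<Sum>i\<in>X. M i) *v v)" by (rule norm_cauchy_schwarz)
  also have "\<dots> \<le> op_norm (\<Sum>i\<in>X. M i)"
    using onorm[OF matrix_vector_mul_bounded_linear, of "\<Sum>i\<in>X. M i" v] v by (simp add: op_norm_def)
  also have "\<dots> \<le> Sup {op_norm (\<Sum>i\<in>I. M i) | I. I \<subseteq> {..<n} \<and> card I = k}"
  proof (rule cSup_upper)
    have "{op_norm (\<Sum>i\<in>I. M i) | I. I \<subseteq> {..<n} \<and> card I = k} = (\<lambda>I. op_norm (\<Sum>i\<in>I. M i)) ` slice n k"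
      by (auto simp: slice_def)
    then show "bdd_above {op_norm (\<Sum>i\<in>I. M i) | I. I \<subseteq> {..<n} \<and> card I = k}"
      by (simp add: finite_slice)
  qed (use X in \<open>auto simp: slice_def\<close>)
  finally show ?thesis .
qed

theorem theorem3p5:
  fixes n k :: nat and p :: "nat \<Rightarrow> real"
    and f :: "(nat \<Rightarrow> bool) \<Rightarrow> complex ^'d ^'d"
    and C :: "nat \<Rightarrow> complex ^'d ^'d"
    and t :: real
  assumes p: "\<forall>i<n. 0 < p i \<and> p i < 1"
    and k: "k \<le> n"
    and herm: "\<forall>x\<in>cube n. hermitian (f x)"
    and Cpsd: "\<forall>i<n. psd (C i)"
    and bdd: "\<forall>x\<in>cube n. \<forall>i<n.
               (f x - f (flip x i)) ** (f x - f (flip x i)) \<preceq>\<^sub>L C i ** C i"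
    and t: "t > 0"
  defines "\<pi> \<equiv> cond_bern n p k"
    and "\<sigma>2 \<equiv> 16 * Sup {op_norm (\<Sum>i\<in>I. C i ** C i) | I. I \<subseteq> {..<n} \<and> card I = k}"
  shows "measure_pmf.prob \<pi>
           {x. lambda_max (f x - measure_pmf.expectation \<pi> f) > t}
         \<le> real CARD('d) * exp (- (t ^ 2) / (\<sigma>2 + sqrt \<sigma>2 * t))"
proof -
  define S where "S = Sup {op_norm (\<Sum>i\<in>I. C i ** C i) | I. I \<subseteq> {..<n} \<and> card I = k}"
  define P where "P X = pmf \<pi> (char_fun X)" for X
  define F where "F X = (*v) (f (char_fun X))" for X
  define q where "q i v = v \<bullet> ((C i ** C i) *v v)" for i v
  define B where "B = {X \<in> slice n k. lambda_max (f (char_fun X) - measure_pmf.expectation \<pi> f) > t}"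
  have cube: "char_fun X \<in> cube n" if "X \<in> slice n k" for X
    using that by (auto simp: slice_def intro: char_fun_cube)
  have step: "(norm (f x *v v - f (flip x i) *v v))\<^sup>2 \<le> q i v" if "x \<in> cube n" "i < n" for x i v
  proof -
    have "hermitian (f x - f (flip x i))"
      using herm that by (intro hermitian_diff) (auto simp: flip_cube)
    from hermitian_inner_square[OF this, of v] show ?thesis
      using bdd that loewner_le_inner[of "(f x - f (flip x i)) ** (f x - f (flip x i))" "C i ** C i" v]
      by (simp add: q_def matrix_vector_mult_diff_rdistrib)
  qed
  have q0: "0 \<le> q i v" if "i < n" for i v
    using Cpsd that by (simp add: q_def hermitian_inner_square psd_def)
  have S: "(\<Sum>i\<in>X. q i v) \<le> S" if "X \<in> slice n k" "norm v = 1" for X v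
    unfolding q_def S_def by (rule sum_inner_le_Sup_op_norm[OF that])
  have diff: "(norm (F X v - F (insert j (X - {i})) v))\<^sup>2 \<le> 2 * (q i v + q j v)"
    if X: "X \<in> slice n k" "i \<in> X" "j < n" "j \<notin> X" for X i j v
  proof -
    let ?x = "char_fun X"
    have i: "i < n" using X by (auto simp: slice_def)
    \<comment> \<open>An exchange is two flips. The intermediate point lies off the slice, so the
      difference bound is used at a point of the cube with only \<open>k - 1\<close> ones.\<close>
    have "(norm (F X v - F (insert j (X - {i})) v))\<^sup>2
        = (norm ((f ?x *v v - f (flip ?x i) *v v) + (f (flip ?x i) *v v - f (flip (flip ?x i) j) *v v)))\<^sup>2"
      by (simp add: F_def flip_char_fun[OF X(2,4)])
    also have "\<dots> \<le> 2 * ((norm (f ?x *v v - f (flip ?x i) *v v))\<^sup>2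
        + (norm (f (flip ?x i) *v v - f (flip (flip ?x i) j) *v v))\<^sup>2)"
      by (rule norm_add_power2_le)
    also have "\<dots> \<le> 2 * (q i v + q j v)"
      using cube[OF X(1)] i X(3) by (intro mult_left_mono add_mono step) (auto simp: flip_cube)
    finally show ?thesis .
  qed
  have S0: "0 \<le> S"
  proof -
    obtain v :: "complex ^ 'd" where v: "norm v = 1" using vector_choose_size[of 1] by auto
    have X: "{..<k} \<in> slice n k" using k by (auto simp: slice_def)
    have "0 \<le> (\<Sum>i\<in>{..<k}. q i v)" using k by (intro sum_nonneg q0) auto
    then show ?thesis using S[OF X v] by linarith
  qed
  have sa: "selfadjoint (F X)" if "X \<in> slice n k" for X
    unfolding F_def using herm cube[OF that] by (intro hermitian_selfadjoint) auto
  have E: "measure_pmf.expectation \<pi> f *v v = (\<Sum>X\<in>slice n k. P X *\<^sub>R F X v)" for v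
    unfolding \<pi>_def expectation_cond_bern[OF p k] P_def F_def
    by (simp add: linear_sum[OF linear_matrix_vector_mult_left] linear_scale[OF linear_matrix_vector_mult_left])
  have hermE: "hermitian (measure_pmf.expectation \<pi> f)"
  proof -
    have "cnj (f (char_fun X) $ j $ i) = f (char_fun X) $ i $ j" if "X \<in> slice n k" for X i j
      using herm cube[OF that] unfolding hermitian_def by metis
    then show ?thesis
      unfolding \<pi>_def expectation_cond_bern[OF p k] hermitian_def by simp
  qed
  have bad: "\<exists>u v. norm u = 1 \<and> norm v = 1 \<and> u \<bullet> v = 0 \<and>
      t \<le> u \<bullet> (F X u - (\<Sum>Y\<in>slice n k. P Y *\<^sub>R F Y u)) \<and>
      t \<le> v \<bullet> (F X v - (\<Sum>Y\<in>slice n k. P Y *\<^sub>R F Y v))" if "X \<in> B" for X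
    using lambda_max_greater_eigenvectors[of "f (char_fun X) - measure_pmf.expectation \<pi> f" t]
      hermitian_diff[OF _ hermE] herm that cube[of X]
    by (simp add: B_def matrix_vector_mult_diff_rdistrib E flip: F_def)
  have prob: "measure_pmf.prob \<pi> {x. lambda_max (f x - measure_pmf.expectation \<pi> f) > t} = (\<Sum>X\<in>B. P X)"
    unfolding B_def P_def \<pi>_def by (rule prob_cond_bern[OF p k])
  show ?thesis
  proof (cases "S = 0")
    \<comment> \<open>Here \<open>\<sigma>2 = 0\<close>, so the exponent is a quotient by zero,
      which equals 0. The right side becomes \<open>CARD('d)\<close>, at least 1.\<close>
    case True
    have "measure_pmf.prob \<pi> {x. lambda_max (f x - measure_pmf.expectation \<pi> f) > t} \<le> 1"
      by (rule measure_pmf.prob_le_1)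
    also have "1 \<le> real CARD('d)" by (simp add: Suc_leI)
    finally show ?thesis using True by (simp add: \<sigma>2_def flip: S_def)
  next
    case False
    define \<sigma> where "\<sigma> = sqrt \<sigma>2"
    have \<sigma>2: "\<sigma>2 = 16 * S" by (simp add: \<sigma>2_def S_def)
    have \<sigma>: "0 < \<sigma>" "\<sigma>\<^sup>2 = \<sigma>2" using False S0 by (auto simp: \<sigma>_def \<sigma>2)
    \<comment> \<open>Half of the exponential parameter, since the trace bound is stated for
      \<open>exp (2 * x)\<close>.\<close>
    define c where "c = t / (\<sigma> * (\<sigma> + t))"
    have b: "4 * c\<^sup>2 * S = t\<^sup>2 / (4 * (\<sigma> + t)\<^sup>2)"
    proof -
      have S: "S = \<sigma>\<^sup>2 / 16" using \<sigma>(2) \<sigma>2 by simp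
      show ?thesis unfolding S using \<sigma>(1) by (simp add: c_def power_divide power_mult_distrib)
    qed
    have c: "0 \<le> c" using \<sigma> t by (simp add: c_def)
    have "2 * exp (2 * (c * t)) * (\<Sum>X\<in>B. P X)
        \<le> real DIM(complex ^ 'd) * (1 + 2 * (4 * c\<^sup>2 * S) / (1 - 4 * c\<^sup>2 * S))"
    proof (rule slice_tail_le[OF _ _ _ sa diff q0 S _ c _ bad])
      show "exchangeable n k P" "(\<Sum>X\<in>slice n k. P X) = 1"
        unfolding P_def \<pi>_def by (rule exchangeable_cond_bern[OF p k] sum_pmf_cond_bern[OF p k])+
      show "4 * c\<^sup>2 * S < 1" unfolding b by (rule bernstein_exponent(1)[OF \<sigma>(1) t])
    qed (auto simp: P_def B_def)
    \<comment> \<open>The real dimension is twice \<open>CARD('d)\<close>, which cancels the factor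
      2 coming from the pair of eigenvectors.\<close>
    then have "exp (2 * (c * t)) * (\<Sum>X\<in>B. P X)
        \<le> real CARD('d) * (1 + 2 * (4 * c\<^sup>2 * S) / (1 - 4 * c\<^sup>2 * S))"
      by simp
    then have "exp (- (2 * (c * t))) * (exp (2 * (c * t)) * (\<Sum>X\<in>B. P X))
        \<le> exp (- (2 * (c * t))) * (real CARD('d) * (1 + 2 * (4 * c\<^sup>2 * S) / (1 - 4 * c\<^sup>2 * S)))"
      by (rule mult_left_mono) simp
    then have "(\<Sum>X\<in>B. P X)
        \<le> real CARD('d) * (exp (- (2 * (c * t))) * (1 + 2 * (4 * c\<^sup>2 * S) / (1 - 4 * c\<^sup>2 * S)))"
      by (simp add: exp_minus mult_ac)
    also have "\<dots> \<le> real CARD('d) * exp (- (t\<^sup>2) / (\<sigma>\<^sup>2 + \<sigma> * t))"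
      unfolding b using bernstein_exponent(2)[OF \<sigma>(1) t]
      by (intro mult_left_mono) (simp_all add: c_def mult.assoc)
    finally show ?thesis by (simp add: prob \<sigma>(2) flip: \<sigma>_def)
  qed
qed

end
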